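(* Let $\mathcal{A} = (Q, q_{\mathsf{init}}, \Sigma, \delta)$ be a permutation automaton and let $x \in \Sigma^\omega$. If $x$ has one of the following properties, then the run $\mathcal{A}(x)$ also has that property (each item being read both without and with the parenthesised word): (1) (effectively) recurrent; (2) (effectively) uniformly recurrent; (3) (effectively) linearly recurrent.
   Context: $\Sigma$ is a finite non-empty alphabet; words are indexed from $0$, $x(n)$ is the $n$-th letter, $x(i,j)$ the factor at positions $i,\dots,j-1$, and $\mathcal{L}(x)$ the set of finite factors of $x$. Automaton (deterministic): $Q$ finite non-empty set of states, $q_{\mathsf{init}}\in Q$, $\delta\colon Q\times\Sigma\to Q$. The run $\mathcal{A}(x)\in(Q\times\Sigma)^\omega$ is the word with $\mathcal{A}(x)(n)=(q_n,x(n))$, where $q_0=q_{\mathsf{init}}$ and $q_{n+1}=\delta(q_n,x(n))$. It is a permutation automaton if for every $a\in\Sigma$ the map $q\mapsto\delta(q,a)$ is a bijection of $Q$. Recurrence: $x$ is recurrent if every factor of $x$ occurs infinitely often in $x$. A return word to a factor $u$ is a word $r$ such that $ru$ is a factor of $x$ containing exactly two occurrences of $u$, one as prefix and one as suffix. A recurrent word is uniformly recurrent if every factor has finitely many return words; then $R_x(n)$ is the length of the longest return word to a length-$n$ factor. A uniformly recurrent $x$ is linearly recurrent if $R_x(n)\in O(n)$. A uniformly (respectively linearly) recurrent word is effectively so if $n\mapsto x(n)$ and $n\mapsto R_x(n)$ are computable. A word $x$ is effectively recurrent if it is recurrent and for any (given) regular language $L$ the following are decidable: (A) is there $N>0$ with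 $x(0,N)\in L$? (B) is there a non-empty $u\in L\cap\mathcal{L}(x)$? *)

theory Defs
  imports
    Complex_Main
    "HOL-Library.Omega_Words_Fun"
    "HOL-Library.Countable"
    "HOL-Library.Nat_Bijection"
    "HOL-Library.Landau_Symbols"
begin

text \<open>
  Alphabets and state sets are types of class \<open>finite\<close> (hence finite and non-empty).
  An infinite word over \<open>'a\<close> is an \<open>'a word = nat \<Rightarrow> 'a\<close> in the sense of
  \<open>Omega_Words_Fun\<close>, and \<open>x[i \<rightarrow> j]\<close> is its factor at positions \<open>i, \<dots>, j - 1\<close>.
\<close>

section \<open>Automata and runs\<close>

record ('q, 'a) automaton =
  init :: 'q
  trans :: "'q \<Rightarrow> 'a \<Rightarrow> 'q"

definition permutation_automaton :: "('q, 'a) automaton \<Rightarrow> bool" where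
  "permutation_automaton A \<longleftrightarrow> (\<forall>a. bij (\<lambda>q. trans A q a))"

primrec run_state :: "('q, 'a) automaton \<Rightarrow> 'a word \<Rightarrow> nat \<Rightarrow> 'q" where
  "run_state A x 0 = init A"
| "run_state A x (Suc n) = trans A (run_state A x n) (x n)"

definition run :: "('q, 'a) automaton \<Rightarrow> 'a word \<Rightarrow> ('q \<times> 'a) word" where
  "run A x = (\<lambda>n. (run_state A x n, x n))"


section \<open>Recurrence\<close>

definition factors :: "'a word \<Rightarrow> 'a list set" where
  "factors x = {x[i \<rightarrow> j] | i j. i \<le> j}"

definition recurrent :: "'a word \<Rightarrow> bool" where
  "recurrent x \<longleftrightarrow> (\<forall>u \<in> factors x. infinite {i. x[i \<rightarrow> i + length u] = u})"

definition occurrences :: "'a list \<Rightarrow> 'a list \<Rightarrow> nat set" where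
  "occurrences u v = {i. i + length u \<le> length v \<and> take (length u) (drop i v) = u}"

text \<open>
  The word \<open>r @ u\<close> always has \<open>u\<close> as a suffix, at position \<open>length r\<close>.
\<close>

definition return_words :: "'a word \<Rightarrow> 'a list \<Rightarrow> 'a list set" where
  "return_words x u =
    {r. r @ u \<in> factors x \<and> card (occurrences u (r @ u)) = 2 \<and>
        0 \<in> occurrences u (r @ u) \<and> length r \<in> occurrences u (r @ u)}"

definition uniformly_recurrent :: "'a word \<Rightarrow> bool" where
  "uniformly_recurrent x \<longleftrightarrow>
    recurrent x \<and> (\<forall>u \<in> factors x. finite (return_words x u))"

text \<open>
  Only used for uniformly recurrent \<open>x\<close> over a finite alphabet, where the set below is finite
  and non-empty.
\<close>

definition max_return :: "'a word \<Rightarrow> nat \<Rightarrow> nat" where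
  "max_return x n =
    Max {length r | u r. u \<in> factors x \<and> length u = n \<and> r \<in> return_words x u}"

definition linearly_recurrent :: "'a word \<Rightarrow> bool" where
  "linearly_recurrent x \<longleftrightarrow>
    uniformly_recurrent x \<and> (\<lambda>n. real (max_return x n)) \<in> O(\<lambda>n. real n)"


section \<open>Computability\<close>

text \<open>
  \<open>recursive_fun n f\<close>: the restriction of \<open>f\<close> to lists of length \<open>n\<close> is a total recursive
  function of \<open>n\<close> arguments. Minimisation is restricted to functions that have a root for all
  values of the parameters, so that only total functions occur; by Kleene's normal form theorem
  these are exactly the total functions among the partial recursive ones. In the recursion
  scheme, the argument list of the step function is \<open>k # (value at k) # parameters\<close>. The last
  rule says that values on lists of other lengths are irrelevant.
\<close>

inductive recursive_fun :: "nat \<Rightarrow> (nat list \<Rightarrow> nat) \<Rightarrow> bool" where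
  zero: "recursive_fun n (\<lambda>xs. 0)"
| succ: "recursive_fun 1 (\<lambda>xs. Suc (hd xs))"
| proj: "i < n \<Longrightarrow> recursive_fun n (\<lambda>xs. xs ! i)"
| comp: "recursive_fun (length gs) f \<Longrightarrow> (\<forall>g \<in> set gs. recursive_fun n g) \<Longrightarrow>
    recursive_fun n (\<lambda>xs. f (map (\<lambda>g. g xs) gs))"
| prec: "recursive_fun n f \<Longrightarrow> recursive_fun (Suc (Suc n)) g \<Longrightarrow>
    recursive_fun (Suc n) (\<lambda>xs. rec_nat (f (tl xs)) (\<lambda>k v. g (k # v # tl xs)) (hd xs))"
| mu: "recursive_fun (Suc n) f \<Longrightarrow> (\<forall>xs. length xs = n \<longrightarrow> (\<exists>k. f (k # xs) = 0)) \<Longrightarrow>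
    recursive_fun n (\<lambda>xs. LEAST k. f (k # xs) = 0)"
| cong: "recursive_fun n f \<Longrightarrow> (\<forall>xs. length xs = n \<longrightarrow> g xs = f xs) \<Longrightarrow> recursive_fun n g"

definition computable :: "(nat \<Rightarrow> nat) \<Rightarrow> bool" where
  "computable f \<longleftrightarrow> recursive_fun 1 (\<lambda>xs. f (hd xs))"

text \<open>
  Letters are coded by the injection \<open>to_nat\<close>. Any two injections of a finite alphabet into the
  natural numbers differ by a function with finite domain, so the choice of the coding is
  irrelevant for computability.
\<close>

definition computable_word :: "'a::finite word \<Rightarrow> bool" where
  "computable_word x \<longleftrightarrow> computable (\<lambda>n. to_nat (x n))"


section \<open>Regular languages as inputs of algorithms\<close>

text \<open>
  A regular language is given to an algorithm by a finite automaton recognising it: lists of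
  initial states, of transitions and of final states, where the states are natural numbers.
  Nondeterministic automata are used because every such triple of lists then is one, and
  they are effectively equivalent to deterministic automata and to regular expressions.
\<close>

datatype 'a nfa =
  NFA (initials: "nat list") (transitions: "(nat \<times> 'a \<times> nat) list") (finals: "nat list")

inductive nfa_path :: "'a nfa \<Rightarrow> nat \<Rightarrow> 'a list \<Rightarrow> nat \<Rightarrow> bool" for M where
  "nfa_path M p [] p"
| "(p, a, q) \<in> set (transitions M) \<Longrightarrow> nfa_path M q w r \<Longrightarrow> nfa_path M p (a # w) r"

definition nfa_lang :: "'a nfa \<Rightarrow> 'a list set" where
  "nfa_lang M = {w. \<exists>p \<in> set (initials M). \<exists>q \<in> set (finals M). nfa_path M p w q}"

definition nfa_code :: "'a::finite nfa \<Rightarrow> nat" where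
  "nfa_code M =
    list_encode
      [list_encode (initials M),
       list_encode (map (\<lambda>(p, a, q). list_encode [p, to_nat a, q]) (transitions M)),
       list_encode (finals M)]"

text \<open>One algorithm has to answer the question for all regular languages.\<close>

definition decidable_for_regular :: "('a::finite list set \<Rightarrow> bool) \<Rightarrow> bool" where
  "decidable_for_regular P \<longleftrightarrow>
    (\<exists>d. computable d \<and> (\<forall>M. d (nfa_code M) = (if P (nfa_lang M) then 1 else 0)))"


section \<open>Effective recurrence\<close>

definition effectively_recurrent :: "'a::finite word \<Rightarrow> bool" where
  "effectively_recurrent x \<longleftrightarrow>
    recurrent x \<and>
    decidable_for_regular (\<lambda>L. \<exists>N>0. x[0 \<rightarrow> N] \<in> L) \<and>
    decidable_for_regular (\<lambda>L. \<exists>u. u \<noteq> [] \<and> u \<in> L \<inter> factors x)"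

definition effectively_uniformly_recurrent :: "'a::finite word \<Rightarrow> bool" where
  "effectively_uniformly_recurrent x \<longleftrightarrow>
    uniformly_recurrent x \<and> computable_word x \<and> computable (max_return x)"

definition effectively_linearly_recurrent :: "'a::finite word \<Rightarrow> bool" where
  "effectively_linearly_recurrent x \<longleftrightarrow>
    linearly_recurrent x \<and> computable_word x \<and> computable (max_return x)"

end

theory Submission
  imports Defs "HOL-Library.Sublist"
begin

text \<open>
  For a word \<open>u\<close> over \<open>Q \<times> \<Sigma>\<close> and a word \<open>v\<close> over \<open>\<Sigma>\<close>, consider the set of states from which
  the run on \<open>v\<close> does not contain \<open>u\<close>. As letters act injectively, its cardinality can only
  decrease when \<open>v\<close> is extended on either side. It decreases strictly when \<open>v\<close> is extended to the
  left by a position at which \<open>u\<close> occurs in the run on \<open>x\<close> and after which it does not occur again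
  within \<open>v\<close>. If \<open>x\<close> is recurrent, a last occurrence of \<open>u\<close> would contradict the minimality of
  this cardinality.
  If \<open>x\<close> is uniformly recurrent, every sufficiently long factor contains this extended \<open>v\<close>, so
  each of \<open>|Q|\<close> iterations of \<open>N \<mapsto> R (N + 1) + N + 1\<close>, where \<open>R\<close> bounds the gaps in \<open>x\<close>, lowers
  the maximal cardinality by one. Hence the gaps in the run are bounded by the \<open>|Q|\<close>-th
  iterate, which is linear or computable if \<open>R\<close> is; this bound also confines the
  computation of the longest return word to a finite part of the run.
  For effective recurrence, question (B) for a word reduces to question (A) for the same word
  and the language of words with a non-empty suffix in \<open>L\<close>, and question (A) for the run
  reduces to question (A) for \<open>x\<close> by a product construction.
\<close>

section \<open>Occurrences and gaps\<close>

lemma subsequence_split: "i \<le> j \<Longrightarrow> j \<le> k \<Longrightarrow> x[i \<rightarrow> k] = x[i \<rightarrow> j] @ x[j \<rightarrow> k]"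
  unfolding subsequence_def map_append[symmetric] using upt_add_eq_append[of i j "k - j"] by simp

lemma subsequence_Cons: "i < j \<Longrightarrow> x[i \<rightarrow> j] = x i # x[Suc i \<rightarrow> j]"
  by (simp add: subsequence_def upt_conv_Cons)

lemma subsequence_eq_iff:
  "x[i \<rightarrow> i + n] = y[j \<rightarrow> j + n] \<longleftrightarrow> (\<forall>k<n. x (i + k) = y (j + k))"
  by (auto simp: list_eq_iff_nth_eq)

lemma subsequence_shift_eq:
  assumes "x[i \<rightarrow> i + n] = x[j \<rightarrow> j + n]" "d + m \<le> n"
  shows "x[i + d \<rightarrow> i + d + m] = x[j + d \<rightarrow> j + d + m]"
  using assms unfolding subsequence_eq_iff by (simp add: add.assoc)

lemma sublist_subsequence_iff:
  assumes "i \<le> j"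
  shows "sublist u (x[i \<rightarrow> j]) \<longleftrightarrow>
    (\<exists>p. i \<le> p \<and> p + length u \<le> j \<and> x[p \<rightarrow> p + length u] = u)"
proof
  assume "sublist u (x[i \<rightarrow> j])"
  then obtain v w where vw: "x[i \<rightarrow> j] = v @ u @ w"
    by (auto simp: sublist_def)
  from arg_cong[OF vw, of length] have len: "j - i = length v + length u + length w"
    by simp
  have "take (length u) (drop (length v) (x[i \<rightarrow> j])) = u"
    by (simp add: vw)
  moreover have "take (length u) (drop (length v) (x[i \<rightarrow> j]))
      = x[i + length v \<rightarrow> i + length v + length u]"
    using len assms by (simp add: min_def)
  ultimately have "x[i + length v \<rightarrow> i + length v + length u] = u" by simp
  then show "\<exists>p. i \<le> p \<and> p + length u \<le> j \<and> x[p \<rightarrow> p + length u] = u"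
    using len assms by (intro exI[of _ "i + length v"]) auto
next
  assume "\<exists>p. i \<le> p \<and> p + length u \<le> j \<and> x[p \<rightarrow> p + length u] = u"
  then obtain p where p: "i \<le> p" "p + length u \<le> j" "x[p \<rightarrow> p + length u] = u" by blast
  have "x[i \<rightarrow> j] = x[i \<rightarrow> p] @ x[p \<rightarrow> p + length u] @ x[p + length u \<rightarrow> j]"
    using p by (simp add: subsequence_split[of i p j] subsequence_split[of p "p + length u" j])
  then show "sublist u (x[i \<rightarrow> j])"
    using p(3) by (metis sublist_appendI)
qed

lemma factors_eq: "factors x = {x[i \<rightarrow> i + n] | i n. True}"
  unfolding factors_def by (metis (no_types, opaque_lifting) le_add1 le_add_diff_inverse)

text \<open>One later occurrence suffices: were the occurrences finitely many, the last one would
  itself be followed by another.\<close>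

lemma recurrent_iff: "recurrent x \<longleftrightarrow> (\<forall>i n. \<exists>p>i. x[p \<rightarrow> p + n] = x[i \<rightarrow> i + n])"
proof
  assume r: "recurrent x"
  show "\<forall>i n. \<exists>p>i. x[p \<rightarrow> p + n] = x[i \<rightarrow> i + n]"
  proof (intro allI)
    fix i n
    have "infinite {p. x[p \<rightarrow> p + length (x[i \<rightarrow> i + n])] = x[i \<rightarrow> i + n]}"
      using r unfolding recurrent_def factors_eq by blast
    then show "\<exists>p>i. x[p \<rightarrow> p + n] = x[i \<rightarrow> i + n]"
      unfolding infinite_nat_iff_unbounded by simp
  qed
next
  assume r: "\<forall>i n. \<exists>p>i. x[p \<rightarrow> p + n] = x[i \<rightarrow> i + n]"
  have "infinite {p. x[p \<rightarrow> p + n] = x[i \<rightarrow> i + n]}" (is "infinite ?S") for i n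
  proof
    assume fin: "finite ?S"
    have "Max ?S \<in> ?S" using fin by (intro Max_in) auto
    moreover obtain p where "p > Max ?S" "x[p \<rightarrow> p + n] = x[Max ?S \<rightarrow> Max ?S + n]"
      using r by blast
    ultimately show False using Max_ge[OF fin, of p] by simp
  qed
  then show "recurrent x"
    unfolding recurrent_def factors_eq by auto
qed

lemma recurrent_after:
  assumes "recurrent x"
  shows "\<exists>p>m. x[p \<rightarrow> p + n] = x[i \<rightarrow> i + n]"
proof -
  have "infinite {p. x[p \<rightarrow> p + length (x[i \<rightarrow> i + n])] = x[i \<rightarrow> i + n]}"
    using assms unfolding recurrent_def factors_eq by blast
  then show ?thesis
    unfolding infinite_nat_iff_unbounded by simp
qed

text \<open>Uniform recurrence stated by positions instead of return words. \<open>R\<close> need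
  not be optimal, so bounds can be composed and estimated; \<open>max_return x\<close> is the
  optimal one when \<open>x\<close> is uniformly recurrent.\<close>

definition gap_bound :: "'a word \<Rightarrow> (nat \<Rightarrow> nat) \<Rightarrow> bool" where
  "gap_bound x R \<longleftrightarrow> (\<forall>i n. \<exists>d. 0 < d \<and> d \<le> R n \<and> x[i + d \<rightarrow> i + d + n] = x[i \<rightarrow> i + n])"

lemma gap_boundE:
  assumes "gap_bound x R"
  obtains d where "0 < d" "d \<le> R n" "x[i + d \<rightarrow> i + d + n] = x[i \<rightarrow> i + n]"
  using assms unfolding gap_bound_def by blast

lemma gap_bound_recurrent: "gap_bound x R \<Longrightarrow> recurrent x"
  unfolding recurrent_iff by (metis gap_boundE less_add_same_cancel1)

text \<open>
  A first occurrence is not the end of a gap; but the prefix of \<open>x\<close> up to it recurs, and there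
  an earlier occurrence precedes it.
\<close>

lemma gap_bound_window:
  assumes gap: "gap_bound x R"
  shows "\<exists>p. i \<le> p \<and> p < i + R n \<and> x[p \<rightarrow> p + n] = x[j \<rightarrow> j + n]"
proof -
  define occ where "occ p \<longleftrightarrow> x[p \<rightarrow> p + n] = x[j \<rightarrow> j + n]" for p
  have rec: "recurrent x" using gap by (rule gap_bound_recurrent)
  have later: "\<exists>p. i \<le> p \<and> p < i + R n \<and> occ p" if l: "occ l" "l < i" for i l
  proof -
    \<comment> \<open>The last occurrence before \<open>i\<close>; the gap that follows it must
      reach into the window, by maximality of \<open>m\<close>.\<close>
    define m where "m = (GREATEST l. l < i \<and> occ l)"
    have m: "m < i \<and> occ m" unfolding m_def
      by (rule GreatestI_nat[of "\<lambda>l. l < i \<and> occ l" l i]) (use l in auto)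
    have mge: "l' \<le> m" if "l' < i" "occ l'" for l'
      unfolding m_def using that by (intro Greatest_le_nat[of "\<lambda>l. l < i \<and> occ l" l' i]) auto
    obtain d where d: "0 < d" "d \<le> R n" "x[m + d \<rightarrow> m + d + n] = x[m \<rightarrow> m + n]"
      using gap by (rule gap_boundE)
    have "occ (m + d)" using d(3) m unfolding occ_def by simp
    moreover from this have "\<not> m + d < i" using mge[of "m + d"] d(1) by auto
    ultimately show ?thesis using d m by (intro exI[of _ "m + d"]) auto
  qed
  define p where "p = (LEAST p. occ p)"
  have p: "occ p" unfolding p_def by (rule LeastI[of _ j]) (simp add: occ_def)
  have pmin: "p \<le> l" if "occ l" for l unfolding p_def using that by (rule Least_le)
  have "p < R n"
  proof -
    obtain q where q: "q > p" "x[q \<rightarrow> q + (p + n)] = x[0 \<rightarrow> 0 + (p + n)]"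
      using recurrent_after[OF rec, of p "p + n" 0] by blast
    have tr: "occ (q + d) \<longleftrightarrow> occ d" if "d \<le> p" for d
      using subsequence_shift_eq[OF q(2), of d n] that unfolding occ_def by simp
    \<comment> \<open>The case already settled applies at \<open>q\<close>, since
      \<open>p < q\<close>. Translated from \<open>q\<close> back to 0, the occurrence
      \<open>l\<close> cannot precede the first one, so \<open>p \<le> l - q < R n\<close>.\<close>
    obtain l where l: "q \<le> l" "l < q + R n" "occ l"
      using later[OF p q(1)] by blast
    have "\<not> l - q < p" using tr[of "l - q"] l pmin[of "l - q"] by auto
    with l show ?thesis by simp
  qed
  show ?thesis
  proof (cases "p < i")
    case True
    then show ?thesis using later[OF p] unfolding occ_def by blast
  next
    case False
    with \<open>p < R n\<close> p show ?thesis unfolding occ_def by (intro exI[of _ p]) auto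
  qed
qed


section \<open>Return words\<close>

text \<open>Occurrences of \<open>u\<close> in \<open>r @ u\<close> correspond to offsets from the
  position where \<open>r @ u\<close> occurs in \<open>x\<close>. A count of two makes the offsets 0
  and \<open>length r\<close> distinct, which is where \<open>r \<noteq> []\<close> comes
  from.\<close>

lemma return_words_iff:
  "r \<in> return_words x u \<longleftrightarrow>
    (\<exists>i. r = x[i \<rightarrow> i + length r] \<and> r \<noteq> [] \<and> x[i \<rightarrow> i + length u] = u \<and>
      x[i + length r \<rightarrow> i + length r + length u] = u \<and>
      (\<forall>d. 0 < d \<and> d < length r \<longrightarrow> x[i + d \<rightarrow> i + d + length u] \<noteq> u))"
  (is "_ \<longleftrightarrow> (\<exists>i. ?Q i)")
proof -
  let ?n = "length r" and ?m = "length u"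
  have occ: "d \<in> occurrences u (x[i \<rightarrow> i + (?n + ?m)]) \<longleftrightarrow>
      d \<le> ?n \<and> x[i + d \<rightarrow> i + d + ?m] = u" for i d
    unfolding occurrences_def by (auto simp: min_def)
  have ru: "x[i \<rightarrow> i + (?n + ?m)] = r @ u \<longleftrightarrow>
      x[i \<rightarrow> i + ?n] = r \<and> x[i + ?n \<rightarrow> i + ?n + ?m] = u" for i
    by (simp add: subsequence_split[of i "i + ?n" "i + (?n + ?m)"] add.assoc)
  have key: "card (occurrences u (r @ u)) = 2 \<and> 0 \<in> occurrences u (r @ u) \<and>
      ?n \<in> occurrences u (r @ u) \<longleftrightarrow> ?Q i"
    if i: "x[i \<rightarrow> i + (?n + ?m)] = r @ u" for i
  proof -
    let ?O = "occurrences u (r @ u)"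
    have O: "d \<in> ?O \<longleftrightarrow> d \<le> ?n \<and> x[i + d \<rightarrow> i + d + ?m] = u" for d
      using occ[of d i] i by simp
    have fin: "finite ?O" by (rule finite_subset[of _ "{..?n}"]) (auto simp: O)
    show ?thesis
    proof
      assume a: "card ?O = 2 \<and> 0 \<in> ?O \<and> ?n \<in> ?O"
      then obtain c d where cd: "?O = {c, d}" "c \<noteq> d" by (auto simp: card_2_iff)
      have "?n \<noteq> 0"
      proof
        assume "?n = 0"
        then have "?O \<subseteq> {0}" using O by auto
        then show False using cd by auto
      qed
      then have "?O = {0, ?n}" using a cd by auto
      moreover have "x[i \<rightarrow> i + ?n] = r" using i ru by simp
      moreover have "x[i + d \<rightarrow> i + d + ?m] \<noteq> u" if "0 < d \<and> d < ?n" for d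
        using that O[of d] \<open>?O = {0, ?n}\<close> by auto
      ultimately show "?Q i" using O[of 0] O[of ?n] \<open>?n \<noteq> 0\<close> by auto
    next
      assume q: "?Q i"
      then have "?O = {0, ?n}" "?n \<noteq> 0"
        by (auto simp: set_eq_iff O)
      then show "card ?O = 2 \<and> 0 \<in> ?O \<and> ?n \<in> ?O" by auto
    qed
  qed
  show ?thesis
  proof
    assume r: "r \<in> return_words x u"
    then have "r @ u \<in> factors x" unfolding return_words_def by blast
    then obtain i l where il: "r @ u = x[i \<rightarrow> i + l]" unfolding factors_eq by blast
    from arg_cong[OF il, of length] have "l = ?n + ?m" by simp
    with il have "x[i \<rightarrow> i + (?n + ?m)] = r @ u" by simp
    from key[OF this] r show "\<exists>i. ?Q i" unfolding return_words_def by blast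
  next
    assume "\<exists>i. ?Q i"
    then obtain i where i: "?Q i" ..
    then have f: "x[i \<rightarrow> i + (?n + ?m)] = r @ u" using ru by simp
    have "x[i \<rightarrow> i + (?n + ?m)] \<in> factors x" unfolding factors_eq by blast
    then have "r @ u \<in> factors x" unfolding f .
    with key[OF f] i show "r \<in> return_words x u" unfolding return_words_def by blast
  qed
qed

lemma return_word_at:
  assumes "0 < d" "x[i + d \<rightarrow> i + d + n] = x[i \<rightarrow> i + n]"
    and "\<And>e. 0 < e \<Longrightarrow> e < d \<Longrightarrow> x[i + e \<rightarrow> i + e + n] \<noteq> x[i \<rightarrow> i + n]"
  shows "x[i \<rightarrow> i + d] \<in> return_words x (x[i \<rightarrow> i + n])"
  unfolding return_words_iff using assms by (intro exI[of _ i]) auto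

text \<open>The least positive shift that brings the factor back spells a return word.\<close>

lemma recurrent_return_word:
  assumes "recurrent x"
  obtains d where "0 < d" "x[i + d \<rightarrow> i + d + n] = x[i \<rightarrow> i + n]"
    "x[i \<rightarrow> i + d] \<in> return_words x (x[i \<rightarrow> i + n])"
proof -
  define P where "P d \<longleftrightarrow> 0 < d \<and> x[i + d \<rightarrow> i + d + n] = x[i \<rightarrow> i + n]" for d
  define d where "d = (LEAST d. P d)"
  obtain p where "p > i" "x[p \<rightarrow> p + n] = x[i \<rightarrow> i + n]"
    using assms unfolding recurrent_iff by blast
  then have "P (p - i)" unfolding P_def by simp
  then have "P d" unfolding d_def by (rule LeastI)
  moreover have "\<not> P e" if "e < d" for e using that not_less_Least unfolding d_def by blast
  ultimately show thesis
    using that[of d] return_word_at[of d x i n] unfolding P_def by blast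
qed

text \<open>Where the return word occurs, a shift by at most \<open>b\<close> meets \<open>u\<close>
  again, and it cannot do so strictly inside the return word.\<close>

lemma return_word_le_gap_bound:
  assumes "\<And>i. \<exists>d. 0 < d \<and> d \<le> b \<and> x[i + d \<rightarrow> i + d + length u] = x[i \<rightarrow> i + length u]"
    and "r \<in> return_words x u"
  shows "length r \<le> b"
proof (rule ccontr)
  assume r: "\<not> length r \<le> b"
  from assms(2) obtain i where i: "x[i \<rightarrow> i + length u] = u"
      "\<forall>d. 0 < d \<and> d < length r \<longrightarrow> x[i + d \<rightarrow> i + d + length u] \<noteq> u"
    unfolding return_words_iff by blast
  obtain d where "0 < d" "d \<le> b" "x[i + d \<rightarrow> i + d + length u] = x[i \<rightarrow> i + length u]"
    using assms(1) by blast
  with i r show False by simp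
qed

lemma finite_return_words:
  fixes x :: "'a::finite word"
  assumes "\<And>r. r \<in> return_words x u \<Longrightarrow> length r \<le> b"
  shows "finite (return_words x u)"
  by (rule finite_subset[OF _ finite_lists_length_le[of "UNIV :: 'a set" b]])
    (use assms in auto)

text \<open>This justifies every later use of \<open>Max\<close>: a finite alphabet has finitely
  many words of length \<open>n\<close>, each factor has finitely many return words, and recurrence
  provides at least one.\<close>

lemma max_return_eq_Max:
  fixes x :: "'a::finite word"
  assumes "uniformly_recurrent x"
  defines "S \<equiv> \<lambda>n. {length r | u r. u \<in> factors x \<and> length u = n \<and> r \<in> return_words x u}"
  shows "finite (S n)" "S n \<noteq> {}" "max_return x n = Max (S n)"
proof -
  have "finite {u :: 'a list. length u = n}"
    using finite_lists_length_eq[of "UNIV :: 'a set" n] by simp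
  then have "finite {u \<in> factors x. length u = n}"
    by (rule rev_finite_subset) auto
  moreover have "S n = (\<Union>u \<in> {u \<in> factors x. length u = n}. length ` return_words x u)"
    unfolding S_def by auto
  ultimately show "finite (S n)"
    using assms(1) unfolding uniformly_recurrent_def by auto
  obtain d where "x[0 \<rightarrow> 0 + d] \<in> return_words x (x[0 \<rightarrow> 0 + n])"
    using recurrent_return_word[of x 0 n] assms(1) unfolding uniformly_recurrent_def by blast
  moreover have "x[0 \<rightarrow> 0 + n] \<in> factors x" unfolding factors_eq by blast
  moreover have "length (x[0 \<rightarrow> 0 + n]) = n" by simp
  ultimately show "S n \<noteq> {}" unfolding S_def by blast
  show "max_return x n = Max (S n)" unfolding S_def max_return_def ..
qed

lemma uniformly_recurrent_gap_bound:
  fixes x :: "'a::finite word"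
  assumes "uniformly_recurrent x"
  shows "gap_bound x (max_return x)"
  unfolding gap_bound_def
proof (intro allI)
  fix i n
  obtain d where d: "0 < d" "x[i + d \<rightarrow> i + d + n] = x[i \<rightarrow> i + n]"
    "x[i \<rightarrow> i + d] \<in> return_words x (x[i \<rightarrow> i + n])"
    using recurrent_return_word[of x i n] assms unfolding uniformly_recurrent_def by blast
  have "x[i \<rightarrow> i + n] \<in> factors x" unfolding factors_eq by blast
  moreover have "length (x[i \<rightarrow> i + n]) = n" "length (x[i \<rightarrow> i + d]) = d" by simp_all
  ultimately have "d \<in> {length r | u r. u \<in> factors x \<and> length u = n \<and> r \<in> return_words x u}"
    using d(3) by (smt (verit, best) mem_Collect_eq)
  then have "d \<le> max_return x n"
    using max_return_eq_Max[OF assms, of n] by simp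
  with d show "\<exists>d. 0 < d \<and> d \<le> max_return x n \<and> x[i + d \<rightarrow> i + d + n] = x[i \<rightarrow> i + n]" by blast
qed

lemma max_return_le:
  fixes x :: "'a::finite word"
  assumes "uniformly_recurrent x"
    and "\<And>i. \<exists>d. 0 < d \<and> d \<le> b \<and> x[i + d \<rightarrow> i + d + n] = x[i \<rightarrow> i + n]"
  shows "max_return x n \<le> b"
proof -
  have "l \<le> b" if "l \<in> {length r | u r. u \<in> factors x \<and> length u = n \<and> r \<in> return_words x u}" for l
    using that return_word_le_gap_bound[of b x] assms(2) by blast
  then show ?thesis using max_return_eq_Max[OF assms(1), of n] by simp
qed

lemma gap_bound_uniformly_recurrent:
  fixes x :: "'a::finite word"
  assumes "gap_bound x R"
  shows "uniformly_recurrent x"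
  unfolding uniformly_recurrent_def
proof (intro conjI ballI)
  show "recurrent x" using assms by (rule gap_bound_recurrent)
  fix u assume "u \<in> factors x"
  show "finite (return_words x u)"
    using return_word_le_gap_bound[of "R (length u)" x u] assms
    by (intro finite_return_words) (auto simp: gap_bound_def)
qed

lemma gap_bound_max_return_le:
  fixes x :: "'a::finite word"
  assumes "gap_bound x R"
  shows "max_return x n \<le> R n"
  using assms max_return_le[OF gap_bound_uniformly_recurrent[OF assms]]
  unfolding gap_bound_def by blast


section \<open>States avoiding a factor\<close>

text \<open>The start state is a parameter because the counting argument compares the runs on one
  word from all states.\<close>

primrec run_from :: "('q, 'a) automaton \<Rightarrow> 'q \<Rightarrow> 'a list \<Rightarrow> ('q \<times> 'a) list" where
  "run_from A q [] = []"
| "run_from A q (a # v) = (q, a) # run_from A (trans A q a) v"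

lemma run_from_append:
  "run_from A q (v @ w) = run_from A q v @ run_from A (foldl (trans A) q v) w"
  by (induction v arbitrary: q) auto

lemma foldl_run_state: "foldl (trans A) (run_state A x i) (x[i \<rightarrow> i + n]) = run_state A x (i + n)"
  by (induction n) auto

lemma run_from_run_state: "run_from A (run_state A x i) (x[i \<rightarrow> i + n]) = run A x[i \<rightarrow> i + n]"
  by (induction n) (auto simp: run_from_append foldl_run_state run_def)

definition avoiding :: "('q, 'a) automaton \<Rightarrow> ('q \<times> 'a) list \<Rightarrow> 'a list \<Rightarrow> 'q set" where
  "avoiding A u v = {q. \<not> sublist u (run_from A q v)}"

lemma inj_foldl_trans: "permutation_automaton A \<Longrightarrow> inj (\<lambda>q. foldl (trans A) q v)"
proof (induction v)
  case (Cons a v)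
  have "inj (\<lambda>q. trans A q a)"
    using Cons.prems bij_is_inj unfolding permutation_automaton_def by blast
  from inj_compose[OF Cons.IH[OF Cons.prems] this] show ?case by (simp add: comp_def)
qed simp

text \<open>Reading the part of \<open>v'\<close> to the left of \<open>v\<close> maps the states
  avoiding \<open>u\<close> on \<open>v'\<close> into those avoiding \<open>u\<close> on
  \<open>v\<close>, and it is injective because all letters act as permutations.\<close>

lemma card_avoiding_mono:
  fixes A :: "('q::finite, 'a) automaton"
  assumes "permutation_automaton A" "sublist v v'"
  shows "card (avoiding A u v') \<le> card (avoiding A u v)"
proof -
  from assms(2) obtain w w' where v': "v' = w @ v @ w'" by (auto simp: sublist_def)
  let ?f = "\<lambda>q. foldl (trans A) q w"
  show ?thesis
  proof (rule card_inj_on_le)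
    show "inj_on ?f (avoiding A u v')"
      using inj_foldl_trans[OF assms(1)] by (rule inj_on_subset) simp
    show "?f ` avoiding A u v' \<subseteq> avoiding A u v"
      unfolding avoiding_def v' run_from_append by (auto intro: sublist_order.order_trans)
  qed simp
qed

text \<open>Reading \<open>a\<close> is again an injection between the avoiding sets, but it misses
  \<open>trans A q a\<close>: this state avoids \<open>u\<close> on \<open>v\<close>, while its only
  preimage \<open>q\<close> does not avoid \<open>u\<close> on \<open>a # v\<close>.\<close>

lemma card_avoiding_less:
  fixes A :: "('q::finite, 'a) automaton"
  assumes "permutation_automaton A"
    and "sublist u (run_from A q (a # v))" "\<not> sublist u (run_from A (trans A q a) v)"
  shows "card (avoiding A u (a # v)) < card (avoiding A u v)"
proof -
  let ?f = "\<lambda>q. trans A q a"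
  have inj: "inj ?f" using assms(1) bij_is_inj unfolding permutation_automaton_def by blast
  have "?f ` avoiding A u (a # v) \<subseteq> avoiding A u v - {?f q}"
  proof clarify
    fix q' assume q': "q' \<in> avoiding A u (a # v)"
    then have "q' \<noteq> q" using assms(2) unfolding avoiding_def by auto
    then have "?f q' \<noteq> ?f q" using inj by (auto dest: injD)
    moreover have "?f q' \<in> avoiding A u v"
      using q' unfolding avoiding_def by (auto simp: sublist_Cons_right)
    ultimately show "?f q' \<in> avoiding A u v - {?f q}" by simp
  qed
  then have "?f ` avoiding A u (a # v) \<subset> avoiding A u v"
    using assms(3) unfolding avoiding_def by blast
  then have "card (?f ` avoiding A u (a # v)) < card (avoiding A u v)"
    by (intro psubset_card_mono) auto
  moreover have "card (?f ` avoiding A u (a # v)) = card (avoiding A u (a # v))"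
    by (rule card_image) (use inj inj_on_subset in blast)
  ultimately show ?thesis by simp
qed

text \<open>The strict decrease is applied to the actual state of the run at position
  \<open>i\<close>. The hypothesis \<open>n \<le> N\<close> lets the occurrence at \<open>i\<close>
  fit into the window of length \<open>Suc N\<close>.\<close>

lemma last_occurrence:
  fixes A :: "('q::finite, 'a) automaton"
  assumes "permutation_automaton A" "n \<le> N"
    and "\<And>p. i < p \<Longrightarrow> p + n \<le> Suc i + N \<Longrightarrow> run A x[p \<rightarrow> p + n] \<noteq> run A x[i \<rightarrow> i + n]"
  defines "u \<equiv> run A x[i \<rightarrow> i + n]"
  shows "card (avoiding A u (x[i \<rightarrow> i + Suc N])) < card (avoiding A u (x[Suc i \<rightarrow> Suc i + N]))"
proof -
  have eq: "x[i \<rightarrow> i + Suc N] = x i # x[Suc i \<rightarrow> Suc i + N]"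
    by (simp add: subsequence_Cons del: subseq_to_Suc)
  have len: "length u = n" unfolding u_def by simp
  show ?thesis unfolding eq
  proof (rule card_avoiding_less[OF assms(1)])
    have "sublist u (run A x[i \<rightarrow> i + Suc N])"
      using assms(2) by (subst sublist_subsequence_iff) (auto simp: len u_def intro!: exI[of _ i])
    then show "sublist u (run_from A (run_state A x i) (x i # x[Suc i \<rightarrow> Suc i + N]))"
      unfolding eq[symmetric] run_from_run_state .
    have "\<not> sublist u (run A x[Suc i \<rightarrow> Suc i + N])"
      using assms(3) by (subst sublist_subsequence_iff) (auto simp: len u_def)
    then show "\<not> sublist u (run_from A (trans A (run_state A x i) (x i)) (x[Suc i \<rightarrow> Suc i + N]))"
      using run_from_run_state[of A x "Suc i" N] by simp
  qed
qed

section \<open>Recurrence of the run\<close>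

theorem recurrent_run:
  fixes A :: "('q::finite, 'a) automaton"
  assumes perm: "permutation_automaton A" and rec: "recurrent x"
  shows "recurrent (run A x)"
proof (rule ccontr)
  assume "\<not> recurrent (run A x)"
  then obtain i n where no: "\<And>p. i < p \<Longrightarrow> run A x[p \<rightarrow> p + n] \<noteq> run A x[i \<rightarrow> i + n]"
    unfolding recurrent_iff by blast
  define u where "u = run A x[i \<rightarrow> i + n]"
  define f where "f N = card (avoiding A u (x[Suc i \<rightarrow> Suc i + N]))" for N
  \<comment> \<open>A window starting right after \<open>i\<close> with the fewest avoiding states,
    among those of length at least \<open>n\<close>.\<close>
  obtain N where N: "n \<le> N" "\<And>M. n \<le> M \<Longrightarrow> f N \<le> f M"
    using ex_has_least_nat[of "\<lambda>N. n \<le> N" n f] by blast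
  let ?v = "x[i \<rightarrow> i + Suc N]"
  have less: "card (avoiding A u ?v) < f N"
    using last_occurrence[OF perm N(1), of i x] no unfolding u_def f_def by blast
  obtain p where p: "p > i" "x[p \<rightarrow> p + Suc N] = ?v"
    using rec unfolding recurrent_iff by blast
  \<comment> \<open>Chosen so that the window starting at \<open>Suc i\<close> ends exactly at
    \<open>p + Suc N\<close> and thus contains the repeated copy of \<open>?v\<close>; then
    \<open>f M < f N\<close>, against minimality.\<close>
  define M where "M = p - i + N"
  have "sublist ?v (x[Suc i \<rightarrow> Suc i + M])"
    using p by (subst sublist_subsequence_iff) (auto simp: M_def intro!: exI[of _ p])
  from card_avoiding_mono[OF perm this, of u] have "f M \<le> card (avoiding A u ?v)"
    unfolding f_def .
  moreover have "f N \<le> f M" using N p by (intro N(2)) (simp add: M_def)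
  ultimately show False using less by simp
qed

section \<open>Gap bounds for the run\<close>

text \<open>If \<open>R\<close> bounds the gaps of \<open>x\<close>, every window of this length
  contains every factor of \<open>x\<close> of length \<open>Suc N\<close>: the factor starts at an
  offset below \<open>R (Suc N)\<close>.\<close>

definition run_gap :: "(nat \<Rightarrow> nat) \<Rightarrow> nat \<Rightarrow> nat" where
  "run_gap R N = R (Suc N) + Suc N"

lemma run_gap_iterate_ge: "n \<le> (run_gap R ^^ k) n"
  by (induction k) (auto simp: run_gap_def)

theorem gap_bound_run:
  fixes A :: "('q::finite, 'a) automaton"
  assumes perm: "permutation_automaton A" and gap: "gap_bound x R"
  shows "gap_bound (run A x) (run_gap R ^^ card (UNIV :: 'q set))"
  unfolding gap_bound_def
proof (intro allI, rule ccontr)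
  let ?y = "run A x"
  fix i n
  define N where "N k = (run_gap R ^^ k) n" for k
  assume no: "\<not> (\<exists>d. 0 < d \<and> d \<le> (run_gap R ^^ card (UNIV :: 'q set)) n \<and>
    ?y[i + d \<rightarrow> i + d + n] = ?y[i \<rightarrow> i + n])"
  define u where "u = ?y[i \<rightarrow> i + n]"
  have Nge: "n \<le> N k" for k unfolding N_def by (rule run_gap_iterate_ge)
  have NSuc: "N (Suc k) = R (Suc (N k)) + Suc (N k)" for k
    unfolding N_def by (simp add: run_gap_def)
  have "mono N"
    by (rule incseq_SucI) (simp add: NSuc)
  have less: "card (avoiding A u (x[i \<rightarrow> i + Suc (N k)]))
      < card (avoiding A u (x[Suc i \<rightarrow> Suc i + N k]))" if k: "k \<le> card (UNIV :: 'q set)" for k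
    unfolding u_def
  proof (rule last_occurrence[OF perm Nge])
    fix p assume p: "i < p" "p + n \<le> Suc i + N k"
    \<comment> \<open>For \<open>n > 0\<close> the window gives
      \<open>p - i \<le> N k + 1 - n \<le> N k\<close>, a shift excluded by \<open>no\<close>. For
      \<open>n = 0\<close> the estimate is off by one; there a shift by 1 already contradicts
      \<open>no\<close>.\<close>
    show "?y[p \<rightarrow> p + n] \<noteq> ?y[i \<rightarrow> i + n]"
    proof (cases "n = 0")
      case True
      obtain K where K: "card (UNIV :: 'q set) = Suc K"
        by (cases "card (UNIV :: 'q set)") auto
      have "1 \<le> N (card (UNIV :: 'q set))" unfolding K NSuc by simp
      moreover have "?y[i + 1 \<rightarrow> i + 1 + n] = ?y[i \<rightarrow> i + n]" using True by simp
      ultimately show ?thesis using no unfolding N_def by (metis zero_less_one)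
    next
      case False
      with p monoD[OF \<open>mono N\<close> k] have "p - i \<le> N (card (UNIV :: 'q set))" "0 < p - i"
        by linarith+
      moreover have "i + (p - i) = p" using p by simp
      ultimately show ?thesis using no unfolding N_def by metis
    qed
  qed
  \<comment> \<open>Each level loses a state: a window of length \<open>N (Suc k)\<close> contains
    \<open>?v\<close>, which by \<open>less\<close> has fewer avoiding states than the window of
    length \<open>N k\<close> after \<open>i\<close>, and the induction hypothesis applies to the
    latter.\<close>
  have bound: "k + card (avoiding A u (x[j \<rightarrow> j + N k])) \<le> card (UNIV :: 'q set)"
    if "k \<le> card (UNIV :: 'q set)" for j k
    using that
  proof (induction k arbitrary: j)
    case 0
    show ?case by (simp add: card_mono)
  next
    case (Suc k)
    let ?v = "x[i \<rightarrow> i + Suc (N k)]"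
    obtain p where p: "j \<le> p" "p < j + R (Suc (N k))" "x[p \<rightarrow> p + Suc (N k)] = ?v"
      using gap_bound_window[OF gap, of j "Suc (N k)" i] by blast
    have "sublist ?v (x[j \<rightarrow> j + N (Suc k)])"
      using p by (subst sublist_subsequence_iff) (auto simp: NSuc intro!: exI[of _ p])
    from card_avoiding_mono[OF perm this, of u] less[of k] Suc.IH[of "Suc i"] Suc.prems
    show ?case by linarith
  qed
  \<comment> \<open>At level \<open>card UNIV\<close> no avoiding state is left, so a further strict
    decrease is impossible.\<close>
  show False
    using bound[of "card (UNIV :: 'q set)" "Suc i"] less[of "card (UNIV :: 'q set)"] by simp
qed

section \<open>Uniform and linear recurrence of the run\<close>

corollary uniformly_recurrent_run:
  fixes A :: "('q::finite, 'a::finite) automaton"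
  assumes "permutation_automaton A" "uniformly_recurrent x"
  shows "uniformly_recurrent (run A x)"
  using assms gap_bound_run uniformly_recurrent_gap_bound gap_bound_uniformly_recurrent by blast

lemma max_return_run_le:
  fixes A :: "('q::finite, 'a::finite) automaton"
  assumes "permutation_automaton A" "uniformly_recurrent x"
  shows "max_return (run A x) n \<le> (run_gap (max_return x) ^^ card (UNIV :: 'q set)) n"
  using assms gap_bound_run uniformly_recurrent_gap_bound gap_bound_max_return_le by blast

text \<open>For \<open>N \<ge> 1\<close>, \<open>N + 1 \<le> 2 * N\<close> turns
  \<open>c * (N + 1) + N + 1\<close> into at most \<open>(2 * c + 2) * N\<close>, so each iteration
  costs one factor. The iterates never drop below \<open>n\<close>, hence the bound on
  \<open>R\<close> stays applicable.\<close>

lemma run_gap_iterate_linear: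
  assumes R: "\<And>n. n \<ge> n0 \<Longrightarrow> real (R n) \<le> c * real n" and c: "c \<ge> 0" and n: "n \<ge> n0" "n \<ge> 1"
  shows "real ((run_gap R ^^ k) n) \<le> (2 * c + 2) ^ k * real n"
proof (induction k)
  case (Suc k)
  define N where "N = (run_gap R ^^ k) n"
  have "N \<ge> n" unfolding N_def by (rule run_gap_iterate_ge)
  with n have N: "n0 \<le> Suc N" "1 \<le> N" by simp_all
  have "real (R (Suc N)) \<le> c * real (Suc N)" by (rule R[OF N(1)])
  also have "\<dots> \<le> c * (2 * real N)" using N(2) c by (intro mult_left_mono) auto
  finally have "real (run_gap R N) \<le> (2 * c + 2) * real N"
    using N(2) unfolding run_gap_def by (simp add: algebra_simps)
  also have "\<dots> \<le> (2 * c + 2) * ((2 * c + 2) ^ k * real n)"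
    using Suc.IH c unfolding N_def by (intro mult_left_mono) auto
  finally show ?case unfolding N_def by (simp add: algebra_simps)
qed simp

corollary linearly_recurrent_run:
  fixes A :: "('q::finite, 'a::finite) automaton"
  assumes perm: "permutation_automaton A" and lin: "linearly_recurrent x"
  shows "linearly_recurrent (run A x)"
proof -
  let ?k = "card (UNIV :: 'q set)"
  have ur: "uniformly_recurrent x" using lin unfolding linearly_recurrent_def by blast
  obtain c where c: "c > 0" "eventually (\<lambda>n. norm (real (max_return x n)) \<le> c * norm (real n)) at_top"
    using lin unfolding linearly_recurrent_def by (blast elim: landau_o.bigE)
  then obtain n0 where n0: "\<And>n. n \<ge> n0 \<Longrightarrow> real (max_return x n) \<le> c * real n"
    unfolding eventually_at_top_linorder by auto
  have "real (max_return (run A x) n) \<le> (2 * c + 2) ^ ?k * real n" if "n \<ge> max n0 1" for n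
  proof -
    have "real (max_return (run A x) n) \<le> real ((run_gap (max_return x) ^^ ?k) n)"
      using max_return_run_le[OF perm ur] by simp
    also have "\<dots> \<le> (2 * c + 2) ^ ?k * real n"
      using n0 c(1) that by (intro run_gap_iterate_linear) auto
    finally show ?thesis .
  qed
  then have "(\<lambda>n. real (max_return (run A x) n)) \<in> O(\<lambda>n. real n)"
    by (intro landau_o.bigI[of "(2 * c + 2) ^ ?k"])
      (use c(1) in \<open>auto simp: eventually_at_top_linorder intro!: exI[of _ "max n0 1"]\<close>)
  with uniformly_recurrent_run[OF perm ur] show ?thesis
    unfolding linearly_recurrent_def by blast
qed


section \<open>Recursive functions\<close>

text \<open>
  Expressions are functions of an environment \<open>xs\<close> of fixed length \<open>n\<close>, and \<open>xs ! i\<close> is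
  its \<open>i\<close>-th variable. A binder extends the environment at the front, so the variables of the
  enclosing scope are found behind \<open>drop\<close>.
\<close>

named_theorems rec_intro

lemma recursive_cong:
  assumes "recursive_fun n f" "\<And>xs. length xs = n \<Longrightarrow> g xs = f xs"
  shows "recursive_fun n g"
  using recursive_fun.cong[of n f g] assms by blast

lemma recursive_comp:
  assumes "recursive_fun (length gs) (\<lambda>ys. f ys)" "\<And>g. g \<in> set gs \<Longrightarrow> recursive_fun n g"
    "\<And>xs. length xs = n \<Longrightarrow> h xs = f (map (\<lambda>g. g xs) gs)"
  shows "recursive_fun n h"
  by (rule recursive_cong[OF recursive_fun.comp[of gs f n]]) (use assms in auto)

lemma recursive_var [rec_intro]: "i < n \<Longrightarrow> recursive_fun n (\<lambda>xs. xs ! i)"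
  by (rule recursive_fun.proj)

lemma recursive_var_drop [rec_intro]: "i + m < n \<Longrightarrow> recursive_fun n (\<lambda>xs. drop m xs ! i)"
  by (rule recursive_cong[OF recursive_fun.proj[of "m + i" n]]) auto

lemma recursive_app1:
  assumes "computable f" "recursive_fun n g"
  shows "recursive_fun n (\<lambda>xs. f (g xs))"
  by (rule recursive_comp[of "[g]" "\<lambda>xs. f (hd xs)"]) (use assms in \<open>auto simp: computable_def\<close>)

definition computable2 :: "(nat \<Rightarrow> nat \<Rightarrow> nat) \<Rightarrow> bool" where
  "computable2 f \<longleftrightarrow> recursive_fun 2 (\<lambda>xs. f (xs ! 0) (xs ! 1))"

lemma recursive_app2:
  assumes "computable2 f" "recursive_fun n g" "recursive_fun n h"
  shows "recursive_fun n (\<lambda>xs. f (g xs) (h xs))"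
  by (rule recursive_comp[of "[g, h]" "\<lambda>xs. f (xs ! 0) (xs ! 1)"])
    (use assms in \<open>auto simp: computable2_def numeral_2_eq_2\<close>)

text \<open>The rule \<open>prec\<close> recurses on the head of the argument list. Composing it
  with \<open>c\<close> and the projections to all variables allows any expression as number of
  steps.\<close>

lemma recursive_rec_nat:
  assumes a: "recursive_fun n a" and c: "recursive_fun n c"
    and g: "recursive_fun (Suc (Suc n)) (\<lambda>xs. g (xs ! 0) (xs ! 1) (drop 2 xs))"
  shows "recursive_fun n (\<lambda>xs. rec_nat (a xs) (\<lambda>k v. g k v xs) (c xs))"
proof -
  let ?r = "\<lambda>xs. rec_nat (a (tl xs)) (\<lambda>k v. g k v (tl xs)) (hd xs)"
  have r: "recursive_fun (Suc n) ?r"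
    by (rule recursive_cong[OF recursive_fun.prec[OF a g]]) simp
  let ?vars = "map (\<lambda>i xs. xs ! i) [0..<n]"
  have vars: "map (\<lambda>f. f xs) ?vars = xs" if "length xs = n" for xs :: "nat list"
    using that by (auto intro: nth_equalityI)
  show ?thesis
  proof (rule recursive_comp[of "c # ?vars" ?r])
    show "recursive_fun (length (c # ?vars)) ?r" using r by simp
    show "recursive_fun n f" if "f \<in> set (c # ?vars)" for f
      using that c recursive_fun.proj by auto
    show "rec_nat (a xs) (\<lambda>k v. g k v xs) (c xs) = ?r (map (\<lambda>f. f xs) (c # ?vars))"
      if "length xs = n" for xs
      using vars[OF that] by simp
  qed
qed

lemma recursive_Suc [rec_intro]:
  assumes "recursive_fun n f"
  shows "recursive_fun n (\<lambda>xs. Suc (f xs))"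
  by (rule recursive_comp[of "[f]" "\<lambda>xs. Suc (hd xs)"])
    (use assms recursive_fun.succ in auto)

lemma recursive_const [rec_intro]: "recursive_fun n (\<lambda>xs. k)"
  by (induction k) (auto intro: recursive_fun.zero recursive_Suc)

lemma recursive_pred_fun [rec_intro]:
  assumes "recursive_fun n f"
  shows "recursive_fun n (\<lambda>xs. f xs - Suc 0)"
proof -
  have "recursive_fun n (\<lambda>xs. rec_nat 0 (\<lambda>k v. k) (f xs))"
    by (rule recursive_rec_nat rec_intro assms | simp)+
  moreover have "rec_nat 0 (\<lambda>k v. k) m = m - Suc 0" for m by (cases m) auto
  ultimately show ?thesis by simp
qed

lemma recursive_add [rec_intro]:
  assumes "recursive_fun n f" "recursive_fun n g"
  shows "recursive_fun n (\<lambda>xs. f xs + g xs)"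
proof -
  have "recursive_fun n (\<lambda>xs. rec_nat (f xs) (\<lambda>k v. Suc v) (g xs))"
    by (rule recursive_rec_nat rec_intro assms | simp)+
  moreover have "rec_nat l (\<lambda>k v. Suc v) m = l + m" for l m by (induction m) auto
  ultimately show ?thesis by simp
qed

lemma recursive_diff [rec_intro]:
  assumes "recursive_fun n f" "recursive_fun n g"
  shows "recursive_fun n (\<lambda>xs. f xs - g xs)"
proof -
  have "recursive_fun n (\<lambda>xs. rec_nat (f xs) (\<lambda>k v. v - Suc 0) (g xs))"
    by (rule recursive_rec_nat rec_intro assms | simp)+
  moreover have "rec_nat l (\<lambda>k v. v - Suc 0) m = l - m" for l m by (induction m) auto
  ultimately show ?thesis by simp
qed

lemma recursive_mult [rec_intro]:
  assumes "recursive_fun n f" "recursive_fun n g"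
  shows "recursive_fun n (\<lambda>xs. f xs * g xs)"
proof -
  have "recursive_fun n (\<lambda>xs. rec_nat 0 (\<lambda>k v. v + f xs) (g xs))"
  proof (rule recursive_rec_nat)
    \<comment> \<open>The counter and the accumulated value now precede the variables, so
      \<open>f\<close> is composed with projections shifted by two.\<close>
    let ?vars = "map (\<lambda>i xs. xs ! (i + 2)) [0..<n]"
    have vars: "map (\<lambda>f. f xs) ?vars = drop 2 xs" if "length xs = Suc (Suc n)" for xs :: "nat list"
      using that by (auto intro: nth_equalityI)
    have "recursive_fun (Suc (Suc n)) (\<lambda>xs. f (drop 2 xs))"
    proof (rule recursive_comp[of ?vars f])
      show "recursive_fun (length ?vars) f" using assms(1) by simp
      show "recursive_fun (Suc (Suc n)) g" if "g \<in> set ?vars" for g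
        using that by (auto intro: recursive_fun.proj)
      show "f (drop 2 xs) = f (map (\<lambda>f. f xs) ?vars)" if "length xs = Suc (Suc n)" for xs
        using vars[OF that] by (simp only:)
    qed
    note f = this
    show "recursive_fun (Suc (Suc n)) (\<lambda>xs. xs ! 1 + f (drop 2 xs))"
      by (rule rec_intro f | simp)+
  qed (rule rec_intro assms)+
  moreover have "rec_nat 0 (\<lambda>k v. v + l) m = l * m" for l m :: nat by (induction m) auto
  ultimately show ?thesis by simp
qed

section \<open>Decidable predicates, bounded quantifiers and minimisation\<close>

definition recursive_pred :: "nat \<Rightarrow> (nat list \<Rightarrow> bool) \<Rightarrow> bool" where
  "recursive_pred n P \<longleftrightarrow> recursive_fun n (\<lambda>xs. if P xs then 1 else 0)"

lemma recursive_pred_not [rec_intro]: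
  "recursive_pred n P \<Longrightarrow> recursive_pred n (\<lambda>xs. \<not> P xs)"
  unfolding recursive_pred_def
  by (rule recursive_cong[OF recursive_diff[OF recursive_const[of n 1]]]) auto

lemma recursive_pred_conj [rec_intro]:
  "recursive_pred n P \<Longrightarrow> recursive_pred n Q \<Longrightarrow> recursive_pred n (\<lambda>xs. P xs \<and> Q xs)"
  unfolding recursive_pred_def by (rule recursive_cong[OF recursive_mult], assumption, assumption) auto

text \<open>With truncated subtraction, \<open>1 - (f xs - g xs)\<close> is the truth value of the
  comparison.\<close>

lemma recursive_pred_le [rec_intro]:
  "recursive_fun n f \<Longrightarrow> recursive_fun n g \<Longrightarrow> recursive_pred n (\<lambda>xs. f xs \<le> g xs)"
  unfolding recursive_pred_def
  by (rule recursive_cong[OF recursive_diff[OF recursive_const[of n 1] recursive_diff[of n f g]]])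
    auto

lemma recursive_pred_eq [rec_intro]:
  "recursive_fun n f \<Longrightarrow> recursive_fun n g \<Longrightarrow> recursive_pred n (\<lambda>xs. f xs = g xs)"
  unfolding eq_iff[of "f _"] by (intro rec_intro)

lemma recursive_if [rec_intro]:
  "recursive_pred n P \<Longrightarrow> recursive_fun n f \<Longrightarrow> recursive_fun n g \<Longrightarrow>
    recursive_fun n (\<lambda>xs. if P xs then f xs else g xs)"
  unfolding recursive_pred_def
  by (rule recursive_cong[OF recursive_add[OF recursive_mult[of n _ f]
          recursive_mult[OF recursive_diff[OF recursive_const[of n 1]], of _ g]]])
    auto

text \<open>The quantifier is a recursion that accumulates a truth value, so it binds two variables:
  \<open>xs ! 0\<close> is the quantified one and \<open>xs ! 1\<close> the accumulator.\<close>

lemma recursive_ball_less [rec_intro]: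
  assumes P: "recursive_pred (Suc (Suc n)) (\<lambda>xs. P (xs ! 0) (drop 2 xs))"
    and f: "recursive_fun n f"
  shows "recursive_pred n (\<lambda>xs. \<forall>k<f xs. P k xs)"
proof -
  have "recursive_fun n (\<lambda>xs. rec_nat 1 (\<lambda>k v. if P k xs then v else 0) (f xs))"
    by (rule recursive_rec_nat rec_intro assms | simp)+
  moreover have "rec_nat 1 (\<lambda>k v. if P k xs then v else 0) m = (if \<forall>k<m. P k xs then 1 else 0 :: nat)"
    for m xs by (induction m) (auto simp: less_Suc_eq)
  ultimately show ?thesis unfolding recursive_pred_def by (simp only:)
qed

lemma recursive_bex_less [rec_intro]:
  assumes P: "recursive_pred (Suc (Suc n)) (\<lambda>xs. P (xs ! 0) (drop 2 xs))"
    and f: "recursive_fun n f"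
  shows "recursive_pred n (\<lambda>xs. \<exists>k<f xs. P k xs)"
proof -
  have "recursive_pred n (\<lambda>xs. \<not> (\<forall>k<f xs. \<not> P k xs))"
    by (intro rec_intro assms)
  then show ?thesis by simp
qed

lemma recursive_Least:
  assumes P: "recursive_pred (Suc n) (\<lambda>xs. P (xs ! 0) (drop 1 xs))"
    and ex: "\<And>xs. length xs = n \<Longrightarrow> \<exists>k. P k xs"
  shows "recursive_fun n (\<lambda>xs. LEAST k. P k xs)"
proof -
  have "recursive_fun (Suc n) (\<lambda>xs. if P (hd xs) (tl xs) then 0 else 1)"
    by (rule recursive_cong[OF recursive_if[OF P recursive_const[of _ 0] recursive_const[of _ 1]]])
      (auto simp: neq_Nil_conv length_Suc_conv)
  moreover have "((if Q then 0 else 1) = (0 :: nat)) = Q" for Q by simp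
  ultimately show ?thesis using recursive_fun.mu[of n "\<lambda>xs. if P (hd xs) (tl xs) then 0 else 1"] ex
    by (simp only: list.sel simp_thms) blast
qed

lemma computableI: "recursive_fun 1 (\<lambda>xs. f (xs ! 0)) \<Longrightarrow> computable f"
  unfolding computable_def by (erule recursive_cong) (auto simp: length_Suc_conv)

lemma computable2I: "recursive_fun 2 (\<lambda>xs. f (xs ! 0) (xs ! 1)) \<Longrightarrow> computable2 f"
  unfolding computable2_def .


section \<open>Codes of pairs and lists\<close>

lemma recursive_prod_encode [rec_intro]:
  assumes "recursive_fun n f" "recursive_fun n g"
  shows "recursive_fun n (\<lambda>xs. prod_encode (f xs, g xs))"
proof -
  have "recursive_fun n (\<lambda>xs. rec_nat 0 (\<lambda>k v. v + Suc k) (f xs + g xs) + f xs)"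
    by (rule recursive_add, rule recursive_rec_nat) (rule rec_intro assms | simp)+
  moreover have "rec_nat 0 (\<lambda>k v. v + Suc k) m = triangle m" for m
    by (induction m) auto
  ultimately show ?thesis by (simp add: prod_encode_def)
qed

abbreviation pfst :: "nat \<Rightarrow> nat" where "pfst z \<equiv> fst (prod_decode z)"
abbreviation psnd :: "nat \<Rightarrow> nat" where "psnd z \<equiv> snd (prod_decode z)"

lemma pfst_le: "pfst z \<le> z" and psnd_le: "psnd z \<le> z"
  using le_prod_encode_1[of "pfst z" "psnd z"] le_prod_encode_2[of "psnd z" "pfst z"] by simp_all

lemma prod_encode_eq_iff: "prod_encode (a, b) = z \<longleftrightarrow> a = pfst z \<and> b = psnd z"
  by (metis fst_conv prod.collapse prod_decode_inverse prod_encode_inverse snd_conv)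

lemma Least_eq_singleton: "(LEAST a. a = c) = (c :: nat)"
  by (rule Least_equality) auto

text \<open>The pairing is inverted by search. The other component is at most \<open>z\<close>,
  which bounds the inner quantifier.\<close>

lemma computable_pfst: "computable pfst"
proof (rule computableI)
  let ?P = "\<lambda>a z. \<exists>b<Suc z. prod_encode (a, b) = z"
  have P: "?P a z \<longleftrightarrow> a = pfst z" for a z
    using psnd_le[of z] by (auto simp: prod_encode_eq_iff less_Suc_eq_le)
  have "recursive_fun 1 (\<lambda>xs. LEAST a. ?P a (xs ! 0))"
    by (rule recursive_Least) (rule rec_intro | simp only: drop_drop | simp add: P)+
  then show "recursive_fun 1 (\<lambda>xs. pfst (xs ! 0))" unfolding P Least_eq_singleton .
qed

lemma computable_psnd: "computable psnd"
proof (rule computableI)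
  let ?P = "\<lambda>b z. \<exists>a<Suc z. prod_encode (a, b) = z"
  have P: "?P b z \<longleftrightarrow> b = psnd z" for b z
    using pfst_le[of z] by (auto simp: prod_encode_eq_iff less_Suc_eq_le)
  have "recursive_fun 1 (\<lambda>xs. LEAST b. ?P b (xs ! 0))"
    by (rule recursive_Least) (rule rec_intro | simp only: drop_drop | simp add: P)+
  then show "recursive_fun 1 (\<lambda>xs. psnd (xs ! 0))" unfolding P Least_eq_singleton .
qed

lemma computable_comp:
  assumes "computable f" "computable g"
  shows "computable (\<lambda>x. f (g x))"
  by (rule computableI)
    (rule recursive_app1[OF assms(1)] recursive_app1[OF assms(2)] rec_intro | simp)+

lemma computable_funpow: "computable f \<Longrightarrow> computable (f ^^ k)"
proof (induction k)
  case 0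
  show ?case by (rule computableI) (simp add: recursive_var)
next
  case (Suc k)
  then have "computable (\<lambda>x. f ((f ^^ k) x))" by (intro computable_comp[of f "f ^^ k"])
  then show ?case by (simp add: comp_def)
qed

definition code_Cons :: "nat \<Rightarrow> nat \<Rightarrow> nat" where
  "code_Cons a z = Suc (prod_encode (a, z))"

definition code_hd :: "nat \<Rightarrow> nat" where
  "code_hd z = pfst (z - Suc 0)"

definition code_tl :: "nat \<Rightarrow> nat" where
  "code_tl z = psnd (z - Suc 0)"

lemma code_Cons_list_encode [simp]: "code_Cons a (list_encode xs) = list_encode (a # xs)"
  by (simp add: code_Cons_def)

lemma code_hd_list_encode [simp]: "code_hd (list_encode (a # xs)) = a"
  by (simp add: code_hd_def)

lemma code_tl_list_encode [simp]: "code_tl (list_encode xs) = list_encode (tl xs)"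
proof (cases xs)
  case Nil
  \<comment> \<open>The empty list has code 0, and truncation makes \<open>code_tl\<close> decode 0
    - 1 = 0, the pair (0, 0); so the tail of the empty list comes out as 0 again.\<close>
  have "prod_encode (0, 0) = 0" by (simp add: prod_encode_def)
  then have "psnd 0 = 0" by (simp add: prod_encode_eq_iff)
  with Nil show ?thesis by (simp add: code_tl_def)
qed (simp add: code_tl_def)

lemma computable_code_hd: "computable code_hd"
  by (rule computableI, unfold code_hd_def)
    (rule rec_intro recursive_app1[OF computable_pfst] | simp)+

lemma computable_code_tl: "computable code_tl"
  by (rule computableI, unfold code_tl_def)
    (rule rec_intro recursive_app1[OF computable_psnd] | simp)+

lemma computable2_code_Cons: "computable2 code_Cons"
  by (rule computable2I, unfold code_Cons_def) (rule rec_intro | simp)+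

text \<open>The code of a list is at least its length, so it can serve as the number of steps.\<close>

definition code_fold :: "(nat \<Rightarrow> nat \<Rightarrow> nat) \<Rightarrow> nat \<Rightarrow> nat \<Rightarrow> nat" where
  "code_fold g a z =
    rec_nat a (\<lambda>k v. if rec_nat z (\<lambda>_. code_tl) k = 0 then v
                     else g (code_hd (rec_nat z (\<lambda>_. code_tl) k)) v) z"

lemma length_le_list_encode: "length xs \<le> list_encode xs"
proof (induction xs)
  case (Cons a xs)
  then show ?case using le_prod_encode_2[of "list_encode xs" a] by simp
qed simp

lemma code_fold_list_encode: "code_fold g a (list_encode xs) = fold g xs a"
proof -
  let ?t = "rec_nat (list_encode xs) (\<lambda>_. code_tl)"
  have t: "?t k = list_encode (drop k xs)" for k
    by (induction k) (simp_all add: drop_Suc tl_drop)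
  \<comment> \<open>Once the list is exhausted the remaining code is 0, and the surplus steps leave
    the value alone.\<close>
  have "rec_nat a (\<lambda>k v. if ?t k = 0 then v else g (code_hd (?t k)) v) m = fold g (take m xs) a" for m
  proof (induction m)
    case (Suc m)
    show ?case
    proof (cases "m < length xs")
      case True
      then have d: "drop m xs = xs ! m # drop (Suc m) xs" by (simp add: Cons_nth_drop_Suc)
      have "take (Suc m) xs = take m xs @ [xs ! m]" using True by (rule take_Suc_conv_app_nth)
      moreover have "code_hd (?t m) = xs ! m" "?t m \<noteq> 0"
        unfolding t d by (simp_all only: code_hd_list_encode) simp
      ultimately show ?thesis using Suc by simp
    next
      case False
      then have "?t m = 0" by (simp add: t)
      with False Suc show ?thesis by simp
    qed
  qed simp
  then show ?thesis
    unfolding code_fold_def using length_le_list_encode[of xs] by simp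
qed

lemma computable2_code_fold:
  assumes g: "computable2 g"
  shows "computable2 (code_fold g)"
  by (rule computable2I, unfold code_fold_def)
    (rule recursive_app1[OF computable_code_tl] recursive_app1[OF computable_code_hd]
      recursive_app2[OF g] recursive_rec_nat rec_intro | simp only: drop_drop | simp)+


section \<open>Computability on coded types\<close>

text \<open>Only the values of \<open>h\<close> on codes are prescribed, so translations need not
  recognise whether a number is a code.\<close>

definition effective :: "('a \<Rightarrow> nat) \<Rightarrow> ('b \<Rightarrow> nat) \<Rightarrow> ('a \<Rightarrow> 'b) \<Rightarrow> bool" where
  "effective c d f \<longleftrightarrow> (\<exists>h. computable h \<and> (\<forall>x. h (c x) = d (f x)))"

lemma effectiveI: "computable h \<Longrightarrow> (\<And>x. h (c x) = d (f x)) \<Longrightarrow> effective c d f"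
  unfolding effective_def by blast

lemma effective_comp:
  assumes "effective c d f" "effective d e g"
  shows "effective c e (\<lambda>x. g (f x))"
proof -
  obtain h k where "computable h" "computable k"
    "\<And>x. h (c x) = d (f x)" "\<And>x. k (d x) = e (g x)"
    using assms unfolding effective_def by blast
  then show ?thesis using computable_comp[of k h] by (intro effectiveI[of "\<lambda>x. k (h x)"]) auto
qed

lemma effective_app2:
  assumes "effective c d f" "effective c d' g" "computable2 h"
    and "\<And>x. h (d (f x)) (d' (g x)) = e (k x)"
  shows "effective c e k"
proof -
  obtain h1 h2 where h: "computable h1" "computable h2"
    "\<And>x. h1 (c x) = d (f x)" "\<And>x. h2 (c x) = d' (g x)"
    using assms unfolding effective_def by blast
  have "computable (\<lambda>x. h (h1 x) (h2 x))"
    by (rule computableI) (rule recursive_app2[OF assms(3)] recursive_app1[OF h(1)]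
        recursive_app1[OF h(2)] rec_intro | simp)+
  then show ?thesis by (rule effectiveI) (simp add: h assms(4))
qed

lemma effective_id: "effective c c (\<lambda>x. x)"
  by (rule effectiveI[of "\<lambda>x. x"], rule computableI) (simp_all add: recursive_var recursive_const)

lemma effective_const: "effective c d (\<lambda>x. k)"
  by (rule effectiveI[of "\<lambda>x. d k"], rule computableI) (simp_all add: recursive_var recursive_const)

text \<open>A lookup table, built by one case distinction per element; injectivity of
  \<open>c\<close> keeps the entries apart.\<close>

lemma effective_finite:
  fixes f :: "'a::finite \<Rightarrow> 'b"
  assumes "inj c"
  shows "effective c d f"
proof -
  have "\<exists>h. computable h \<and> (\<forall>x\<in>S. h (c x) = d (f x))" for S :: "'a set"
  proof (induction S rule: infinite_finite_induct)
    case empty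
    have "computable (\<lambda>x. 0)" by (rule computableI) (rule rec_intro)
    then show ?case by blast
  next
    case (insert s S)
    then obtain h where h: "computable h" "\<And>x. x \<in> S \<Longrightarrow> h (c x) = d (f x)" by blast
    have "computable (\<lambda>z. if z = c s then d (f s) else h z)"
      by (rule computableI) (rule rec_intro recursive_app1[OF h(1)] | simp)+
    moreover have "(if c x = c s then d (f s) else h (c x)) = d (f x)" if "x \<in> insert s S" for x
      using that h(2) injD[OF assms, of x s] by auto
    ultimately show ?case by blast
  qed simp
  from this[of UNIV] show ?thesis unfolding effective_def by simp
qed

lemma effective_to_nat:
  fixes f :: "'a::finite \<Rightarrow> 'b"
  assumes "effective c to_nat g"
  shows "effective c d (\<lambda>x. f (g x))"
  by (rule effective_comp[OF assms effective_finite]) (rule inj_to_nat)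

lemma effective_prod_encode:
  assumes "effective c d f" "effective c d' g"
  shows "effective c id (\<lambda>x. prod_encode (d (f x), d' (g x)))"
proof (rule effective_app2[OF assms])
  show "computable2 (\<lambda>a b. prod_encode (a, b))"
    by (rule computable2I) (rule rec_intro | simp)+
qed simp

definition list_code :: "('a \<Rightarrow> nat) \<Rightarrow> 'a list \<Rightarrow> nat" where
  "list_code c xs = list_encode (map c xs)"

lemma effective_Cons:
  assumes "effective c d f" "effective c (list_code d) g"
  shows "effective c (list_code d) (\<lambda>x. f x # g x)"
  by (rule effective_app2[OF assms computable2_code_Cons]) (simp add: list_code_def)

text \<open>
  The reversal is what folding \<open>Cons\<close> over the input produces; only the set of elements matters
  for the lists of an automaton.
\<close>

definition expand :: "('a \<Rightarrow> 'b) list \<Rightarrow> 'a list \<Rightarrow> 'b list \<Rightarrow> 'b list" where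
  "expand fs xs ys = concat (map (\<lambda>x. map (\<lambda>f. f x) fs) (rev xs)) @ ys"

lemma set_expand [simp]: "set (expand fs xs ys) = (\<Union>f\<in>set fs. f ` set xs) \<union> set ys"
  by (auto simp: expand_def)

lemma effective_expand:
  assumes "\<And>f. f \<in> set fs \<Longrightarrow> effective c d f"
    and "effective b (list_code c) xs" "effective b (list_code d) ys"
  shows "effective b (list_code d) (\<lambda>x. expand fs (xs x) (ys x))"
proof -
  \<comment> \<open>The function to be folded: it puts the images of one element under all of
    \<open>fs\<close> in front of the accumulator. As \<open>fs\<close> is fixed and not an input,
    induction on it composes finitely many computable functions.\<close>
  have "\<exists>g. computable2 g \<and>
      (\<forall>x ys. g (c x) (list_code d ys) = list_code d (map (\<lambda>f. f x) fs @ ys))"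
    using assms(1)
  proof (induction fs)
    case Nil
    have "computable2 (\<lambda>a v. v)" by (rule computable2I) (rule rec_intro, simp)
    then show ?case by auto
  next
    case (Cons f fs)
    then obtain g where g: "computable2 g"
      "\<And>x ys. g (c x) (list_code d ys) = list_code d (map (\<lambda>f. f x) fs @ ys)" by auto
    obtain h where h: "computable h" "\<And>x. h (c x) = d (f x)"
      using Cons.prems unfolding effective_def by auto
    have "computable2 (\<lambda>a v. code_Cons (h a) (g a v))"
      by (rule computable2I) (rule recursive_app2[OF computable2_code_Cons]
          recursive_app2[OF g(1)] recursive_app1[OF h(1)] rec_intro | simp)+
    moreover have "code_Cons (h (c x)) (g (c x) (list_code d ys))
        = list_code d (map (\<lambda>f. f x) (f # fs) @ ys)" for x ys
      unfolding g(2) h(2) by (simp add: list_code_def)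
    ultimately show ?case by (intro exI conjI allI)
  qed
  then obtain g where g: "computable2 g"
    "\<And>x ys. g (c x) (list_code d ys) = list_code d (map (\<lambda>f. f x) fs @ ys)" by blast
  have fold: "fold g (map c xs) (list_code d ys) = list_code d (expand fs xs ys)" for xs ys
    by (induction xs arbitrary: ys) (simp_all add: expand_def g(2))
  show ?thesis
    by (rule effective_app2[OF assms(3,2) computable2_code_fold[OF g(1)]])
      (simp add: list_code_def[of c] code_fold_list_encode fold)
qed


section \<open>Reductions between automata\<close>

definition trans_code :: "nat \<times> 'a::finite \<times> nat \<Rightarrow> nat" where
  "trans_code = (\<lambda>(p, a, q). list_encode [p, to_nat a, q])"

lemma nfa_code_eq:
  "nfa_code M = list_encode
    [list_code id (initials M), list_code trans_code (transitions M), list_code id (finals M)]"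
  by (simp add: nfa_code_def list_code_def trans_code_def)

lemma effective_trans_code_sel:
  "effective trans_code id (\<lambda>t. fst t)"
  "effective trans_code to_nat (\<lambda>t. fst (snd t))"
  "effective trans_code id (\<lambda>t. snd (snd t))"
proof -
  show "effective trans_code id (\<lambda>t. fst t)"
    by (rule effectiveI[OF computable_code_hd]) (auto simp: trans_code_def simp del: list_encode.simps)
  show "effective trans_code to_nat (\<lambda>t. fst (snd t))"
    by (rule effectiveI[OF computable_comp[OF computable_code_hd computable_code_tl]])
      (auto simp: trans_code_def simp del: list_encode.simps)
  show "effective trans_code id (\<lambda>t. snd (snd t))"
    by (rule effectiveI[OF computable_comp[OF computable_code_hd
            computable_comp[OF computable_code_tl computable_code_tl]]])
      (auto simp: trans_code_def simp del: list_encode.simps)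
qed

lemma effective_nfa_code_sel:
  "effective nfa_code (list_code id) initials"
  "effective nfa_code (list_code trans_code) transitions"
  "effective nfa_code (list_code id) finals"
proof -
  show "effective nfa_code (list_code id) initials"
    by (rule effectiveI[OF computable_code_hd]) (simp add: nfa_code_eq del: list_encode.simps)
  show "effective nfa_code (list_code trans_code) transitions"
    by (rule effectiveI[OF computable_comp[OF computable_code_hd computable_code_tl]])
      (simp add: nfa_code_eq del: list_encode.simps)
  show "effective nfa_code (list_code id) finals"
    by (rule effectiveI[OF computable_comp[OF computable_code_hd
            computable_comp[OF computable_code_tl computable_code_tl]]])
      (simp add: nfa_code_eq del: list_encode.simps)
qed

text \<open>Transitions and automata are both coded by lists of three entries, so this one rule
  serves for both.\<close>

lemma effective_list_encode3:
  assumes "effective c d1 f1" "effective c d2 f2" "effective c d3 f3"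
    and "\<And>x. e (k x) = list_encode [d1 (f1 x), d2 (f2 x), d3 (f3 x)]"
  shows "effective c e k"
proof -
  have wrap: "effective c id (\<lambda>x. d (f x))" if "effective c d f"
    for d :: "'z \<Rightarrow> nat" and f
    using that unfolding effective_def by simp
  have "effective c (list_code id) (\<lambda>x. [d1 (f1 x), d2 (f2 x), d3 (f3 x)])"
    using assms(1-3)[THEN effective_comp, OF effective_id]
    by (intro effective_Cons effective_const) (auto simp: effective_def)
  then show ?thesis
    unfolding effective_def list_code_def by (simp add: assms(4))
qed

lemma effective_trans_code:
  assumes "effective c id p" "effective c to_nat a" "effective c id q"
  shows "effective c trans_code (\<lambda>x. (p x, a x, q x))"
  by (rule effective_list_encode3[OF assms]) (simp add: trans_code_def)

lemma effective_nfa_code: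
  assumes "effective c (list_code id) i" "effective c (list_code trans_code) t"
    "effective c (list_code id) f"
  shows "effective c nfa_code (\<lambda>x. NFA (i x) (t x) (f x))"
  by (rule effective_list_encode3[OF assms]) (simp add: nfa_code_eq)

lemma decidable_for_regular_reduce:
  assumes "effective nfa_code nfa_code T" "decidable_for_regular P"
    and "\<And>M. Q (nfa_lang M) \<longleftrightarrow> P (nfa_lang (T M))"
  shows "decidable_for_regular Q"
proof -
  obtain h d where "computable h" "\<And>M. h (nfa_code M) = nfa_code (T M)"
    "computable d" "\<And>M. d (nfa_code M) = (if P (nfa_lang M) then 1 else 0)"
    using assms(1,2) unfolding effective_def decidable_for_regular_def by blast
  then show ?thesis
    unfolding decidable_for_regular_def assms(3)
    by (intro exI[of _ "\<lambda>x. d (h x)"]) (simp add: computable_comp)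
qed

section \<open>Paths and the product construction\<close>

lemma nfa_path_Nil_iff: "nfa_path M p [] r \<longleftrightarrow> r = p"
  by (auto intro: nfa_path.intros elim: nfa_path.cases)

lemma nfa_path_Cons_iff:
  "nfa_path M p (a # w) r \<longleftrightarrow> (\<exists>q. (p, a, q) \<in> set (transitions M) \<and> nfa_path M q w r)"
  by (auto intro: nfa_path.intros elim: nfa_path.cases)

definition all_elements :: "'a::finite list" where
  "all_elements = (SOME xs. set xs = UNIV)"

lemma set_all_elements [simp]: "set all_elements = UNIV"
  unfolding all_elements_def by (rule someI_ex) (simp add: finite_list)


text \<open>A product of \<open>A\<close> and \<open>M\<close>: a state codes a state
  \<open>q\<close> of \<open>A\<close> with a state \<open>p\<close> of \<open>M\<close>. The letter
  of a transition of \<open>M\<close> already names the state of \<open>A\<close>, so each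
  transition of \<open>M\<close> yields a single one; final states are paired with every
  \<open>q\<close>.\<close>

definition run_nfa :: "('q::finite, 'a::finite) automaton \<Rightarrow> ('q \<times> 'a) nfa \<Rightarrow> 'a nfa" where
  "run_nfa A M = NFA
    (expand [\<lambda>p. prod_encode (to_nat (init A), p)] (initials M) [])
    (expand [\<lambda>t. (prod_encode (to_nat (fst (fst (snd t))), fst t), snd (fst (snd t)),
                  prod_encode (to_nat (trans A (fst (fst (snd t))) (snd (fst (snd t)))), snd (snd t)))]
      (transitions M) [])
    (expand (map (\<lambda>(q :: 'q) p. prod_encode (to_nat q, p)) all_elements) (finals M) [])"

lemma effective_run_nfa:
  fixes A :: "('a::finite, 'b::finite) automaton"
  shows "effective nfa_code nfa_code (run_nfa A)"
proof -
  have q: "effective trans_code to_nat (\<lambda>t. fst (fst (snd t)))"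
    by (rule effective_to_nat[of trans_code _ to_nat fst]) (rule effective_trans_code_sel)
  have a: "effective trans_code to_nat (\<lambda>t. snd (fst (snd t)))"
    by (rule effective_to_nat[of trans_code _ to_nat snd]) (rule effective_trans_code_sel)
  have q': "effective trans_code to_nat (\<lambda>t. trans A (fst (fst (snd t))) (snd (fst (snd t))))"
    by (rule effective_to_nat[of trans_code _ to_nat "\<lambda>s. trans A (fst s) (snd s)"])
      (rule effective_trans_code_sel)
  have state: "effective id id (\<lambda>p. prod_encode (to_nat q, p))" for q :: 'a
    using effective_prod_encode[OF effective_const[of id to_nat q] effective_id[of id]] by simp
  have pair: "effective trans_code id (\<lambda>t. prod_encode (to_nat (f t), g t))"
    if "effective trans_code to_nat f" "effective trans_code id g" for f :: "_ \<Rightarrow> 'a" and g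
    using effective_prod_encode[OF that] by simp
  show ?thesis
    unfolding run_nfa_def
  proof (intro effective_nfa_code effective_expand effective_nfa_code_sel effective_const)
    fix f :: "nat \<Rightarrow> nat"
    assume "f \<in> set [\<lambda>p. prod_encode (to_nat (init A), p)]"
    then show "effective id id f" using state by simp
  next
    fix f :: "nat \<times> ('a \<times> 'b) \<times> nat \<Rightarrow> nat \<times> 'b \<times> nat"
    assume "f \<in> set [\<lambda>t. (prod_encode (to_nat (fst (fst (snd t))), fst t), snd (fst (snd t)),
      prod_encode (to_nat (trans A (fst (fst (snd t))) (snd (fst (snd t)))), snd (snd t)))]"
    moreover have "effective trans_code trans_code
        (\<lambda>t. (prod_encode (to_nat (fst (fst (snd t))), fst t), snd (fst (snd t)),
          prod_encode (to_nat (trans A (fst (fst (snd t))) (snd (fst (snd t)))), snd (snd t))))"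
      by (intro effective_trans_code pair q q' a effective_trans_code_sel)
    ultimately show "effective trans_code trans_code f" by simp
  next
    fix f :: "nat \<Rightarrow> nat"
    assume "f \<in> set (map (\<lambda>q p. prod_encode (to_nat q, p)) (all_elements :: 'a list))"
    then show "effective id id f" using state by auto
  qed (rule effective_nfa_code_sel)+
qed

lemma run_nfa_transitions:
  "(prod_encode (to_nat q, p), a, r) \<in> set (transitions (run_nfa A M)) \<longleftrightarrow>
    (\<exists>p'. r = prod_encode (to_nat (trans A q a), p') \<and> (p, (q, a), p') \<in> set (transitions M))"
  unfolding run_nfa_def by (force simp: image_iff)

lemma nfa_path_run_nfa:
  "nfa_path (run_nfa A M) (prod_encode (to_nat q, p)) w r \<longleftrightarrow>
    (\<exists>p'. r = prod_encode (to_nat (foldl (trans A) q w), p') \<and> nfa_path M p (run_from A q w) p')"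
proof (induction w arbitrary: q p)
  case Nil
  show ?case by (simp add: nfa_path_Nil_iff)
next
  case (Cons a w)
  show ?case
    unfolding nfa_path_Cons_iff run_nfa_transitions run_from.simps foldl_Cons
    using Cons.IH by blast
qed

lemma nfa_lang_run_nfa:
  fixes A :: "('q::finite, 'a::finite) automaton"
  shows "nfa_lang (run_nfa A M) = {w. run_from A (init A) w \<in> nfa_lang M}"
proof -
  have "set (initials (run_nfa A M)) = (\<lambda>p. prod_encode (to_nat (init A), p)) ` set (initials M)"
    "set (finals (run_nfa A M)) = {prod_encode (to_nat (q :: 'q), p) | q p. p \<in> set (finals M)}"
    unfolding run_nfa_def by auto
  then show ?thesis
    unfolding nfa_lang_def by (auto simp: nfa_path_run_nfa) blast
qed

lemma decidable_prefix_run: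
  assumes "decidable_for_regular (\<lambda>L. \<exists>N>0. x[0 \<rightarrow> N] \<in> L)"
  shows "decidable_for_regular (\<lambda>L. \<exists>N>0. run A x[0 \<rightarrow> N] \<in> L)"
  using effective_run_nfa[of A] assms
proof (rule decidable_for_regular_reduce)
  show "(\<exists>N>0. run A x[0 \<rightarrow> N] \<in> nfa_lang M) \<longleftrightarrow> (\<exists>N>0. x[0 \<rightarrow> N] \<in> nfa_lang (run_nfa A M))"
    for M
    using run_from_run_state[of A x 0] by (simp add: nfa_lang_run_nfa)
qed

text \<open>
  Recognises the words with a non-empty suffix in the language of \<open>M\<close>: copy \<open>0\<close> of an initial
  state waits for the suffix to begin, copy \<open>1\<close> simulates \<open>M\<close> after the first letter of
  the suffix.
\<close>

definition suffix_nfa :: "'a::finite nfa \<Rightarrow> 'a nfa" where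
  "suffix_nfa M = NFA
    (expand [\<lambda>p. prod_encode (0, p)] (initials M) [])
    (expand (map (\<lambda>k t. (prod_encode (k, fst t), fst (snd t), prod_encode (1, snd (snd t)))) [0, 1])
      (transitions M)
      (expand (map (\<lambda>a p. (prod_encode (0, p), a, prod_encode (0, p))) all_elements) (initials M) []))
    (expand [\<lambda>p. prod_encode (1, p)] (finals M) [])"

lemma effective_suffix_nfa: "effective nfa_code nfa_code (suffix_nfa :: 'a::finite nfa \<Rightarrow> 'a nfa)"
proof -
  have pair: "effective c id (\<lambda>t. prod_encode (k, f t))"
    if "effective c id f" for k and f :: "'z \<Rightarrow> nat" and c
    using effective_prod_encode[OF effective_const[of c id k] that] by simp
  have state: "effective id id (\<lambda>p. prod_encode (k, p))" for k
    using pair[OF effective_id] by simp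
  show ?thesis
    unfolding suffix_nfa_def
  proof (intro effective_nfa_code effective_expand effective_nfa_code_sel effective_const)
    fix f :: "nat \<times> 'a \<times> nat \<Rightarrow> nat \<times> 'a \<times> nat"
    assume "f \<in> set (map (\<lambda>k t. (prod_encode (k, fst t), fst (snd t), prod_encode (1, snd (snd t)))) [0, 1])"
    then obtain k where
      f: "f = (\<lambda>t. (prod_encode (k, fst t), fst (snd t), prod_encode (1, snd (snd t))))" by auto
    show "effective trans_code trans_code f" unfolding f
      by (intro effective_trans_code pair effective_trans_code_sel)
  next
    fix f :: "nat \<Rightarrow> nat \<times> 'a \<times> nat"
    assume "f \<in> set (map (\<lambda>a p. (prod_encode (0, p), a, prod_encode (0, p))) all_elements)"
    then obtain a where f: "f = (\<lambda>p. (prod_encode (0, p), a, prod_encode (0, p)))" by auto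
    show "effective id trans_code f" unfolding f
      by (intro effective_trans_code state effective_const)
  qed (auto intro: state effective_nfa_code_sel)
qed

lemma suffix_nfa_transitions:
  "(prod_encode (1, p), a, r) \<in> set (transitions (suffix_nfa M)) \<longleftrightarrow>
    (\<exists>p'. r = prod_encode (1, p') \<and> (p, a, p') \<in> set (transitions M))"
  "(prod_encode (0, p), a, r) \<in> set (transitions (suffix_nfa M)) \<longleftrightarrow>
    (\<exists>p'. r = prod_encode (1, p') \<and> (p, a, p') \<in> set (transitions M)) \<or>
    r = prod_encode (0, p) \<and> p \<in> set (initials M)"
  unfolding suffix_nfa_def by (force simp: image_iff)+

lemma nfa_path_suffix_nfa1:
  "nfa_path (suffix_nfa M) (prod_encode (1, p)) w r \<longleftrightarrow>
    (\<exists>p'. r = prod_encode (1, p') \<and> nfa_path M p w p')"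
proof (induction w arbitrary: p)
  case Nil
  show ?case by (simp add: nfa_path_Nil_iff)
next
  case (Cons a w)
  show ?case
    unfolding nfa_path_Cons_iff suffix_nfa_transitions using Cons.IH by blast
qed

lemma nfa_path_suffix_nfa0:
  assumes "p \<in> set (initials M)"
  shows "nfa_path (suffix_nfa M) (prod_encode (0, p)) w (prod_encode (1, p')) \<longleftrightarrow>
    (\<exists>v u. w = v @ u \<and> u \<noteq> [] \<and> nfa_path M p u p')"
proof (induction w)
  case Nil
  show ?case by (simp add: nfa_path_Nil_iff)
next
  case (Cons a w)
  \<comment> \<open>The first letter either opens the suffix and leads to copy 1, or is skipped by
    the loop at \<open>p\<close>.\<close>
  have "nfa_path (suffix_nfa M) (prod_encode (0, p)) (a # w) (prod_encode (1, p')) \<longleftrightarrow>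
    nfa_path M p (a # w) p' \<or> (\<exists>v u. w = v @ u \<and> u \<noteq> [] \<and> nfa_path M p u p')"
    unfolding nfa_path_Cons_iff suffix_nfa_transitions
    using Cons assms nfa_path_suffix_nfa1[of M _ w "prod_encode (1, p')"] by auto
  also have "\<dots> \<longleftrightarrow> (\<exists>v u. a # w = v @ u \<and> u \<noteq> [] \<and> nfa_path M p u p')"
    unfolding Cons_eq_append_conv by blast
  finally show ?case .
qed

lemma nfa_lang_suffix_nfa: "nfa_lang (suffix_nfa M) = {v @ u | v u. u \<noteq> [] \<and> u \<in> nfa_lang M}"
proof -
  have "set (initials (suffix_nfa M)) = (\<lambda>p. prod_encode (0, p)) ` set (initials M)"
    "set (finals (suffix_nfa M)) = (\<lambda>p. prod_encode (1, p)) ` set (finals M)"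
    unfolding suffix_nfa_def by auto
  then have lang: "w \<in> nfa_lang (suffix_nfa M) \<longleftrightarrow> (\<exists>p\<in>set (initials M). \<exists>p'\<in>set (finals M).
      \<exists>v u. w = v @ u \<and> u \<noteq> [] \<and> nfa_path M p u p')" for w
    unfolding nfa_lang_def by (simp add: nfa_path_suffix_nfa0 del: One_nat_def cong: bex_cong)
  show ?thesis
  proof (intro equalityI subsetI)
    fix w assume "w \<in> nfa_lang (suffix_nfa M)"
    then obtain p p' v u where "w = v @ u" "u \<noteq> []"
      "p \<in> set (initials M)" "p' \<in> set (finals M)" "nfa_path M p u p'"
      unfolding lang by blast
    moreover from this have "u \<in> nfa_lang M" unfolding nfa_lang_def by blast
    ultimately show "w \<in> {v @ u | v u. u \<noteq> [] \<and> u \<in> nfa_lang M}" by blast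
  next
    fix w assume "w \<in> {v @ u | v u. u \<noteq> [] \<and> u \<in> nfa_lang M}"
    then obtain v u where w: "w = v @ u" "u \<noteq> []" "u \<in> nfa_lang M" by blast
    then obtain p p' where "p \<in> set (initials M)" "p' \<in> set (finals M)" "nfa_path M p u p'"
      unfolding nfa_lang_def by blast
    with w(1,2) show "w \<in> nfa_lang (suffix_nfa M)" unfolding lang by metis
  qed
qed

text \<open>Every factor is a suffix of the prefix that ends where it ends. This holds for any word,
  so it yields question (B) for the run from question (A) for the run.\<close>

lemma decidable_factor:
  fixes x :: "'a::finite word"
  assumes "decidable_for_regular (\<lambda>L. \<exists>N>0. x[0 \<rightarrow> N] \<in> L)"
  shows "decidable_for_regular (\<lambda>L. \<exists>u. u \<noteq> [] \<and> u \<in> L \<inter> factors x)"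
  using effective_suffix_nfa assms
proof (rule decidable_for_regular_reduce)
  fix M :: "'a nfa"
  show "(\<exists>u. u \<noteq> [] \<and> u \<in> nfa_lang M \<inter> factors x) \<longleftrightarrow>
    (\<exists>N>0. x[0 \<rightarrow> N] \<in> nfa_lang (suffix_nfa M))"
  proof
    assume "\<exists>u. u \<noteq> [] \<and> u \<in> nfa_lang M \<inter> factors x"
    then obtain i n where u: "x[i \<rightarrow> i + n] \<noteq> []" "x[i \<rightarrow> i + n] \<in> nfa_lang M"
      unfolding factors_eq by blast
    have "x[0 \<rightarrow> i + n] = x[0 \<rightarrow> i] @ x[i \<rightarrow> i + n]" by (rule subsequence_split) auto
    with u have "x[0 \<rightarrow> i + n] \<in> nfa_lang (suffix_nfa M)" unfolding nfa_lang_suffix_nfa by blast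
    moreover have "i + n > 0" using u(1) by simp
    ultimately show "\<exists>N>0. x[0 \<rightarrow> N] \<in> nfa_lang (suffix_nfa M)" by blast
  next
    assume "\<exists>N>0. x[0 \<rightarrow> N] \<in> nfa_lang (suffix_nfa M)"
    then obtain N v u where u: "x[0 \<rightarrow> N] = v @ u" "u \<noteq> []" "u \<in> nfa_lang M"
      unfolding nfa_lang_suffix_nfa by blast
    then have "sublist u (x[0 \<rightarrow> N])" by simp
    then obtain p where "x[p \<rightarrow> p + length u] = u"
      using sublist_subsequence_iff[of 0 N u x] by auto
    then have "u \<in> factors x" unfolding factors_eq by (metis (mono_tags, lifting) mem_Collect_eq)
    with u show "\<exists>u. u \<noteq> [] \<and> u \<in> nfa_lang M \<inter> factors x" by blast
  qed
qed

theorem effectively_recurrent_run: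
  fixes A :: "('q::finite, 'a::finite) automaton"
  assumes "permutation_automaton A" "effectively_recurrent x"
  shows "effectively_recurrent (run A x)"
  using assms recurrent_run decidable_prefix_run decidable_factor
  unfolding effectively_recurrent_def by blast


section \<open>Computing the run and its longest return words\<close>

lemma computable_word_run:
  fixes A :: "('q::finite, 'a::finite) automaton"
  assumes x: "computable_word x"
  shows "computable_word (run A x)"
proof -
  \<comment> \<open>On \<open>'q \<times> 'a\<close>, \<open>to_nat\<close> is merely some
    injection, unrelated to \<open>prod_encode\<close>. Since both types are finite, the transition
    function and the change of coding are finite tables \<open>h\<close> and \<open>k\<close> on
    these pair codes.\<close>
  define pair :: "'q \<times> 'a \<Rightarrow> nat" where "pair s = prod_encode (to_nat (fst s), to_nat (snd s))" for s
  have "inj pair" unfolding pair_def by (auto intro!: injI simp: prod_eq_iff)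
  then have "effective pair to_nat (\<lambda>s. trans A (fst s) (snd s))" "effective pair to_nat (\<lambda>s. s)"
    by (rule effective_finite)+
  then obtain h k where h: "computable h" "\<And>s. h (pair s) = to_nat (trans A (fst s) (snd s))"
    and k: "computable k" "\<And>s. k (pair s) = to_nat s"
    unfolding effective_def by blast
  have h2: "h (prod_encode (to_nat q, to_nat a)) = to_nat (trans A q a)"
    and k2: "k (prod_encode (to_nat q, to_nat a)) = to_nat (q, a)" for q a
    using h(2)[of "(q, a)"] k(2)[of "(q, a)"] by (simp_all add: pair_def)
  have state: "rec_nat (to_nat (init A)) (\<lambda>n v. h (prod_encode (v, to_nat (x n)))) n
      = to_nat (run_state A x n)" for n
    by (induction n) (simp_all add: h2)
  have "computable (\<lambda>n. k (prod_encode
    (rec_nat (to_nat (init A)) (\<lambda>n v. h (prod_encode (v, to_nat (x n)))) n, to_nat (x n))))"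
    by (rule computableI)
      (rule recursive_app1[OF k(1)] recursive_app1[OF h(1)] recursive_rec_nat
        recursive_app1[OF x[unfolded computable_word_def]] rec_intro | simp)+
  then show ?thesis unfolding computable_word_def state k2 run_def .
qed

text \<open>
  A factor of length \<open>B n + n\<close> contains the whole gap after its prefix of length \<open>n\<close>, and all
  such factors occur at positions below \<open>B (B n + n)\<close>.
\<close>

lemma max_return_eq_Least:
  fixes x :: "'a::finite word"
  assumes gap: "gap_bound x B"
  shows "max_return x n =
    (LEAST k. \<forall>i<B (B n + n). \<exists>d<k. \<forall>j<n. x (i + Suc d + j) = x (i + j))"
    (is "_ = (LEAST k. ?P k)")
proof -
  have ur: "uniformly_recurrent x" using gap by (rule gap_bound_uniformly_recurrent)
  \<comment> \<open>Shifts are positive: \<open>d < k\<close> in the search stands for the shift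
    \<open>Suc d \<le> k\<close>.\<close>
  have P: "?P k \<longleftrightarrow> (\<forall>i<B (B n + n). \<exists>d. 0 < d \<and> d \<le> k \<and> x[i + d \<rightarrow> i + d + n] = x[i \<rightarrow> i + n])"
    for k
    unfolding subsequence_eq_iff by (metis Suc_le_eq gr0_conv_Suc zero_less_Suc)
  show ?thesis
  proof (rule Least_equality[symmetric])
    show "?P (max_return x n)"
      unfolding P using uniformly_recurrent_gap_bound[OF ur] unfolding gap_bound_def by blast
  next
    fix k assume k: "?P k"
    \<comment> \<open>If \<open>k < B n\<close>, a shift by at most \<open>k\<close> stays inside
      the factor of length \<open>B n + n\<close> and can be carried from a position
      \<open>p\<close> below the search bound to any \<open>i\<close>. Otherwise \<open>B n\<close>
      bounds the return words already.\<close>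
    show "max_return x n \<le> k"
    proof (cases "B n \<le> k")
      case True
      then show ?thesis using gap_bound_max_return_le[OF gap, of n] by simp
    next
      case False
      show ?thesis
      proof (rule max_return_le[OF ur])
        fix i
        obtain p where p: "p < B (B n + n)" "x[p \<rightarrow> p + (B n + n)] = x[i \<rightarrow> i + (B n + n)]"
          using gap_bound_window[OF gap, of 0 "B n + n" i] by auto
        obtain d where d: "0 < d" "d \<le> k" "x[p + d \<rightarrow> p + d + n] = x[p \<rightarrow> p + n]"
          using k p(1) unfolding P by blast
        have "x[p + d \<rightarrow> p + d + n] = x[i + d \<rightarrow> i + d + n]"
          by (rule subsequence_shift_eq[OF p(2)]) (use d False in simp)
        moreover have "x[p + 0 \<rightarrow> p + 0 + n] = x[i + 0 \<rightarrow> i + 0 + n]"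
          by (rule subsequence_shift_eq[OF p(2)]) simp
        ultimately show "\<exists>d. 0 < d \<and> d \<le> k \<and> x[i + d \<rightarrow> i + d + n] = x[i \<rightarrow> i + n]"
          using d by (intro exI[of _ d]) simp
      qed
    qed
  qed
qed

lemma computable_max_return:
  fixes x :: "'a::finite word"
  assumes gap: "gap_bound x B" and B: "computable B" and x: "computable_word x"
  shows "computable (max_return x)"
proof (rule computableI)
  \<comment> \<open>Letters are compared through their codes to make the predicate recursive;
    injectivity of \<open>to_nat\<close> restores equality of letters.\<close>
  let ?P = "\<lambda>k n. \<forall>i<B (B n + n). \<exists>d<k. \<forall>j<n. to_nat (x (i + Suc d + j)) = to_nat (x (i + j))"
  have "recursive_fun 1 (\<lambda>xs. LEAST k. ?P k (xs ! 0))"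
  proof (rule recursive_Least)
    show "recursive_pred (Suc 1) (\<lambda>xs. ?P (xs ! 0) (drop 1 xs ! 0))"
      by (rule recursive_app1[OF x[unfolded computable_word_def]] recursive_app1[OF B] rec_intro
          | simp only: drop_drop | simp)+
    \<comment> \<open>The search terminates because the gap bound itself is a solution.\<close>
    show "\<exists>k. ?P k (xs ! 0)" for xs
    proof (rule exI[of _ "B (xs ! 0)"], intro allI impI)
      fix i
      obtain d where "0 < d" "d \<le> B (xs ! 0)" "x[i + d \<rightarrow> i + d + (xs ! 0)] = x[i \<rightarrow> i + (xs ! 0)]"
        using gap by (rule gap_boundE)
      then show "\<exists>d<B (xs ! 0). \<forall>j<xs ! 0. to_nat (x (i + Suc d + j)) = to_nat (x (i + j))"
        unfolding subsequence_eq_iff by (intro exI[of _ "d - 1"]) auto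
    qed
  qed
  then show "recursive_fun 1 (\<lambda>xs. max_return x (xs ! 0))"
    unfolding max_return_eq_Least[OF gap] by simp
qed

text \<open>The gap bound of the run is an iterate whose number of iterations is the constant
  \<open>card UNIV\<close>, hence computable by finitely many compositions.\<close>

lemma computable_max_return_run:
  fixes A :: "('q::finite, 'a::finite) automaton"
  assumes A: "permutation_automaton A" and x: "uniformly_recurrent x" "computable_word x"
    and R: "computable (max_return x)"
  shows "computable (max_return (run A x))"
proof (rule computable_max_return)
  show "gap_bound (run A x) (run_gap (max_return x) ^^ card (UNIV :: 'q set))"
    using gap_bound_run[OF A] uniformly_recurrent_gap_bound[OF x(1)] by blast
  have "computable (run_gap (max_return x))"
    by (rule computableI, unfold run_gap_def) (rule recursive_app1[OF R] rec_intro | simp)+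
  then show "computable (run_gap (max_return x) ^^ card (UNIV :: 'q set))"
    by (rule computable_funpow)
  show "computable_word (run A x)" using x(2) by (rule computable_word_run)
qed

theorem lemma5p2:
  fixes A :: "('q::finite, 'a::finite) automaton" and x :: "'a word"
  assumes "permutation_automaton A"
  shows "(recurrent x \<longrightarrow> recurrent (run A x)) \<and>
         (effectively_recurrent x \<longrightarrow> effectively_recurrent (run A x)) \<and>
         (uniformly_recurrent x \<longrightarrow> uniformly_recurrent (run A x)) \<and>
         (effectively_uniformly_recurrent x \<longrightarrow> effectively_uniformly_recurrent (run A x)) \<and>
         (linearly_recurrent x \<longrightarrow> linearly_recurrent (run A x)) \<and>
         (effectively_linearly_recurrent x \<longrightarrow> effectively_linearly_recurrent (run A x))"
proof -
  have "linearly_recurrent x \<Longrightarrow> uniformly_recurrent x"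
    unfolding linearly_recurrent_def by blast
  then show ?thesis
    using recurrent_run[OF assms] effectively_recurrent_run[OF assms]
      uniformly_recurrent_run[OF assms] linearly_recurrent_run[OF assms]
      computable_word_run[of x A] computable_max_return_run[OF assms]
    unfolding effectively_uniformly_recurrent_def effectively_linearly_recurrent_def by blast
qed

end
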